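(* Let $d\ge 1$ be an integer, let $\varphi:\mathbb{R}^2\to\mathbb{R}$ be final-time data, and let $u^\varepsilon(t,m,\xi,\eta)$ be the scaled value function defined by the dynamic programming principle (see context) with $u^\varepsilon(T,m,\xi,\eta)=\varphi(\xi,\eta)$. Let $C_d^*$ be the optimal value of the market's linear program, and let $u(t,\xi,\eta)$ be a solution of $$u_t+\tfrac12 C_d^*\Big\langle D^2u\,\frac{\nabla^\perp u}{u_\eta},\frac{\nabla^\perp u}{u_\eta}\Big\rangle=0\ \ (t<T),\qquad u(T,\xi,\eta)=\varphi(\xi,\eta).$$ Assume that $u$ satisfies: (i) $u$ has continuous, uniformly bounded derivatives in $(\xi,\eta)$ of order up to $4$; $u_t$ has continuous, uniformly bounded derivatives in $(\xi,\eta)$ of order up to $2$; and $u_{tt}$ is continuous and uniformly bounded, all bounds being uniform as $t\uparrow T$; (ii) $u_\eta>c>0$ for some constant $c$ uniform in space and time; (iii) $|u_\xi|\le u_\eta$; (iv) $u_t\le 0$. Then there is a constant $C$ (independent of $\varepsilon$, $t$, and $T$) such that $$u^\varepsilon(t,m,\xi,\eta)\ge u(t,\xi,\eta)-C\,[(T-t)+\varepsilon]\,\varepsilon\qquad\text{for } t<T,\ \xi\in\mathbb{R},\ \eta\in\mathbb{R},\ m\in\{0,1\}^d,$$ whenever $\varepsilon>0$ is small enough and $t$ is such that $N=(T-t)/\varepsilon^2$ is an integer.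
   Context: States and experts. The states are $m=(a_1,\dots,a_d)\in\{0,1\}^d$ (with $a_d$ the most recent entry), identified with the integers $0,\dots,2^d-1$ by reading $a_1\cdots a_d$ in binary. For a state $m$ put $m_+=(a_2,\dots,a_d,1)$ and $m_-=(a_2,\dots,a_d,0)$; for $b=\pm1$ write $m_b=m_+$ if $b=1$ and $m_b=m_-$ if $b=-1$. Two experts are given by functions $q,r:\{0,1\}^d\to\mathbb{R}$ with $|q(m)|<1$ and $|r(m)|<1$ for all $m$, and $q(m)\ne r(m)$ for at least one $m$. Value function. For $\varepsilon>0$, $u^\varepsilon(t,m,\xi,\eta)$ is defined for times $t\le T$ with $(T-t)/\varepsilon^2$ a nonnegative integer, $m\in\{0,1\}^d$, $(\xi,\eta)\in\mathbb{R}^2$, by $u^\varepsilon(T,m,\xi,\eta)=\varphi(\xi,\eta)$ and, working backward in time, $$u^\varepsilon(t,m,\xi,\eta)=\min_{|f|\le1}\max_{b=\pm1}u^\varepsilon\big(t+\varepsilon^2,\,m_b,\,\xi+\varepsilon b[q(m)-r(m)],\,\eta+\varepsilon b[q(m)+r(m)-2f]\big).$$ Notation. $\nabla^\perp u=(-u_\eta,u_\xi)$ and $D^2u$ is the Hessian of $u$ in $(\xi,\eta)$. Graph and linear program. Consider the directed graph (the $d$-dimensional de Bruijn graph on 2 symbols) with vertex set $\{0,1\}^d$ and edges from $m$ to $m_+$ and from $m$ to $m_-$ for each $m$. A simple cycle is a closed walk with at least one edge and no repeated vertices apart from the first and last, which are equal (loops count as simple cycles of length one; cycles differing only in the starting vertex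 are identified). For a simple cycle $s$ let $|s|$ be its number of edges, and for a vertex $m$ on $s$ let $b_{s,m}=+1$ if $s$ leaves $m$ by the edge to $m_+$ and $b_{s,m}=-1$ if it leaves $m$ by the edge to $m_-$. The market's linear program is: over $(\beta_0,\dots,\beta_{2^d-1},M)\in\mathbb{R}^{2^d+1}$, maximize $M$ subject to $$\sum_{m\text{ on }s}\big[(q(m)-r(m))^2-b_{s,m}\beta_m\big]\ge |s|\,M\quad\text{for every simple cycle } s.$$ *)

theory Defs
  imports "HOL-Analysis.Analysis" "Graph_Theory.Arc_Walk"
begin

subsection \<open>States, dynamic programming\<close>

text \<open>A state is the list \<open>[a\<^sub>1, \<dots>, a\<^sub>d]\<close>, most recent entry last. A market move is a real
  \<open>b\<close> equal to 1 or -1; \<open>next_state m b\<close> is \<open>m\<^sub>b\<close>.\<close>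

definition states :: "nat \<Rightarrow> bool list set" where
  "states d = {m. length m = d}"

definition next_state :: "bool list \<Rightarrow> real \<Rightarrow> bool list" where
  "next_state m b = tl m @ [b = 1]"

text \<open>The value function with \<open>n\<close> steps of size \<open>\<epsilon>\<^sup>2\<close> left. The minimum over \<open>f\<close> is written as an
  infimum; it is attained whenever the final-time data are continuous.\<close>

primrec value_steps ::
  "(bool list \<Rightarrow> real) \<Rightarrow> (bool list \<Rightarrow> real) \<Rightarrow> (real \<Rightarrow> real \<Rightarrow> real) \<Rightarrow> real
    \<Rightarrow> nat \<Rightarrow> bool list \<Rightarrow> real \<Rightarrow> real \<Rightarrow> real" where
  "value_steps q r \<phi> \<epsilon> 0 m \<xi> \<eta> = \<phi> \<xi> \<eta>"
| "value_steps q r \<phi> \<epsilon> (Suc n) m \<xi> \<eta> =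
     (INF f\<in>{f. \<bar>f\<bar> \<le> 1}. MAX b\<in>{1, -1}.
        value_steps q r \<phi> \<epsilon> n (next_state m b)
          (\<xi> + \<epsilon> * b * (q m - r m)) (\<eta> + \<epsilon> * b * (q m + r m - 2 * f)))"

text \<open>Only meaningful when \<open>(T - t) / \<epsilon>\<^sup>2\<close> is a nonnegative integer; the two lemmas below are then
  the defining equations.\<close>

definition value_fn ::
  "(bool list \<Rightarrow> real) \<Rightarrow> (bool list \<Rightarrow> real) \<Rightarrow> (real \<Rightarrow> real \<Rightarrow> real) \<Rightarrow> real \<Rightarrow> real
    \<Rightarrow> real \<Rightarrow> bool list \<Rightarrow> real \<Rightarrow> real \<Rightarrow> real" where
  "value_fn q r \<phi> T \<epsilon> t = value_steps q r \<phi> \<epsilon> (nat \<lfloor>(T - t) / \<epsilon>\<^sup>2\<rfloor>)"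

lemma value_fn_final: "value_fn q r \<phi> T \<epsilon> T m \<xi> \<eta> = \<phi> \<xi> \<eta>"
  by (simp add: value_fn_def)

lemma value_fn_dpp:
  assumes "\<epsilon> > 0" "(T - t) / \<epsilon>\<^sup>2 = real N" "N > 0"
  shows "value_fn q r \<phi> T \<epsilon> t m \<xi> \<eta> =
     (INF f\<in>{f. \<bar>f\<bar> \<le> 1}. MAX b\<in>{1, -1}.
        value_fn q r \<phi> T \<epsilon> (t + \<epsilon>\<^sup>2) (next_state m b)
          (\<xi> + \<epsilon> * b * (q m - r m)) (\<eta> + \<epsilon> * b * (q m + r m - 2 * f)))"
proof -
  obtain n where n: "N = Suc n" using assms(3) by (cases N) auto
  have "(T - (t + \<epsilon>\<^sup>2)) / \<epsilon>\<^sup>2 = (T - t) / \<epsilon>\<^sup>2 - 1"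
    using assms(1) by (simp add: field_simps)
  also have "\<dots> = real n" using assms(2) n by simp
  finally have "(T - (t + \<epsilon>\<^sup>2)) / \<epsilon>\<^sup>2 = real n" .
  then have "nat \<lfloor>(T - (t + \<epsilon>\<^sup>2)) / \<epsilon>\<^sup>2\<rfloor> = n" by (simp only: floor_of_nat nat_int)
  moreover have "nat \<lfloor>(T - t) / \<epsilon>\<^sup>2\<rfloor> = Suc n"
    using assms(2) n by (simp only: floor_of_nat nat_int)
  ultimately show ?thesis unfolding value_fn_def by simp
qed

subsection \<open>The de Bruijn graph and the market's linear program\<close>

text \<open>The arc \<open>(m, b)\<close> is the edge from \<open>m\<close> to \<open>m\<^sub>b\<close>, so the arcs on a cycle carry the numbers
  \<open>b\<^bsub>s,m\<^esub>\<close>. The library predicate \<open>cycle\<close> requires at least one arc, distinct vertices apart from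
  the endpoints, and admits loops.\<close>

definition de_bruijn :: "nat \<Rightarrow> (bool list, bool list \<times> real) pre_digraph" where
  "de_bruijn d = \<lparr>verts = states d, arcs = states d \<times> {1, -1},
                  tail = fst, head = (\<lambda>(m, b). next_state m b)\<rparr>"

definition lp_feasible ::
  "nat \<Rightarrow> (bool list \<Rightarrow> real) \<Rightarrow> (bool list \<Rightarrow> real) \<Rightarrow> (bool list \<Rightarrow> real) \<Rightarrow> real \<Rightarrow> bool" where
  "lp_feasible d q r \<beta> M \<longleftrightarrow>
     (\<forall>s. pre_digraph.cycle (de_bruijn d) s \<longrightarrow>
        (\<Sum>(m, b)\<leftarrow>s. (q m - r m)\<^sup>2 - b * \<beta> m) \<ge> real (length s) * M)"

definition lp_value :: "nat \<Rightarrow> (bool list \<Rightarrow> real) \<Rightarrow> (bool list \<Rightarrow> real) \<Rightarrow> real" where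
  "lp_value d q r = Sup {M. \<exists>\<beta>. lp_feasible d q r \<beta> M}"

subsection \<open>Derivatives, regularity, and the equation\<close>

definition Dt :: "(real \<Rightarrow> real \<Rightarrow> real \<Rightarrow> real) \<Rightarrow> real \<Rightarrow> real \<Rightarrow> real \<Rightarrow> real" where
  "Dt g t \<xi> \<eta> = deriv (\<lambda>s. g s \<xi> \<eta>) t"

definition Dxi :: "(real \<Rightarrow> real \<Rightarrow> real \<Rightarrow> real) \<Rightarrow> real \<Rightarrow> real \<Rightarrow> real \<Rightarrow> real" where
  "Dxi g t \<xi> \<eta> = deriv (\<lambda>x. g t x \<eta>) \<xi>"

definition Deta :: "(real \<Rightarrow> real \<Rightarrow> real \<Rightarrow> real) \<Rightarrow> real \<Rightarrow> real \<Rightarrow> real \<Rightarrow> real" where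
  "Deta g t \<xi> \<eta> = deriv (\<lambda>y. g t \<xi> y) \<eta>"

definition t_differentiable :: "real \<Rightarrow> (real \<Rightarrow> real \<Rightarrow> real \<Rightarrow> real) \<Rightarrow> bool" where
  "t_differentiable T g \<longleftrightarrow> (\<forall>t<T. \<forall>\<xi> \<eta>. (\<lambda>s. g s \<xi> \<eta>) differentiable (at t))"

definition space_differentiable :: "real \<Rightarrow> (real \<Rightarrow> real \<Rightarrow> real \<Rightarrow> real) \<Rightarrow> bool" where
  "space_differentiable T g \<longleftrightarrow>
     (\<forall>t<T. \<forall>\<xi> \<eta>. (\<lambda>x. g t x \<eta>) differentiable (at \<xi>) \<and> (\<lambda>y. g t \<xi> y) differentiable (at \<eta>))"

definition cont_bounded :: "real \<Rightarrow> real \<Rightarrow> (real \<Rightarrow> real \<Rightarrow> real \<Rightarrow> real) \<Rightarrow> bool" where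
  "cont_bounded T K g \<longleftrightarrow>
     continuous_on {(t, \<xi>, \<eta>). t < T} (\<lambda>(t, \<xi>, \<eta>). g t \<xi> \<eta>) \<and>
     (\<forall>t<T. \<forall>\<xi> \<eta>. \<bar>g t \<xi> \<eta>\<bar> \<le> K)"

text \<open>All partial derivatives in \<open>(\<xi>, \<eta>)\<close> of order 0 to \<open>k\<close> exist for \<open>t < T\<close>, are jointly
  continuous, and are bounded by \<open>K\<close>.\<close>

primrec space_CB :: "nat \<Rightarrow> real \<Rightarrow> real \<Rightarrow> (real \<Rightarrow> real \<Rightarrow> real \<Rightarrow> real) \<Rightarrow> bool" where
  "space_CB 0 T K g \<longleftrightarrow> cont_bounded T K g"
| "space_CB (Suc k) T K g \<longleftrightarrow>
     cont_bounded T K g \<and> space_differentiable T g \<and>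
     space_CB k T K (Dxi g) \<and> space_CB k T K (Deta g)"

text \<open>The bound is imposed on the derivatives of \<open>u\<close> of order 1 to 4 and not on \<open>u\<close> itself, which
  cannot be bounded if \<open>u\<^sub>\<eta> > c > 0\<close>.\<close>

definition regular_with_bound :: "real \<Rightarrow> real \<Rightarrow> (real \<Rightarrow> real \<Rightarrow> real \<Rightarrow> real) \<Rightarrow> bool" where
  "regular_with_bound T K u \<longleftrightarrow>
     space_differentiable T u \<and> space_CB 3 T K (Dxi u) \<and> space_CB 3 T K (Deta u) \<and>
     t_differentiable T u \<and> space_CB 2 T K (Dt u) \<and>
     t_differentiable T (Dt u) \<and> cont_bounded T K (Dt (Dt u))"

definition perp_grad :: "(real \<Rightarrow> real \<Rightarrow> real \<Rightarrow> real) \<Rightarrow> real \<Rightarrow> real \<Rightarrow> real \<Rightarrow> real \<times> real" where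
  "perp_grad u t \<xi> \<eta> = (- Deta u t \<xi> \<eta>, Dxi u t \<xi> \<eta>)"

definition hessian ::
  "(real \<Rightarrow> real \<Rightarrow> real \<Rightarrow> real) \<Rightarrow> real \<Rightarrow> real \<Rightarrow> real \<Rightarrow> real \<times> real \<Rightarrow> real \<times> real" where
  "hessian u t \<xi> \<eta> v =
     (Dxi (Dxi u) t \<xi> \<eta> * fst v + Deta (Dxi u) t \<xi> \<eta> * snd v,
      Dxi (Deta u) t \<xi> \<eta> * fst v + Deta (Deta u) t \<xi> \<eta> * snd v)"

text \<open>The final-time condition includes that the data are attained as \<open>t\<close> increases to \<open>T\<close>; the
  equation alone does not connect \<open>u T\<close> with the values for \<open>t < T\<close>.\<close>

definition solves_pde ::
  "real \<Rightarrow> real \<Rightarrow> (real \<Rightarrow> real \<Rightarrow> real) \<Rightarrow> (real \<Rightarrow> real \<Rightarrow> real \<Rightarrow> real) \<Rightarrow> bool" where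
  "solves_pde Cstar T \<phi> u \<longleftrightarrow>
     (\<forall>t<T. \<forall>\<xi> \<eta>.
        let v = perp_grad u t \<xi> \<eta> /\<^sub>R Deta u t \<xi> \<eta>
        in Dt u t \<xi> \<eta> + 1/2 * Cstar * (hessian u t \<xi> \<eta> v \<bullet> v) = 0) \<and>
     (\<forall>\<xi> \<eta>. u T \<xi> \<eta> = \<phi> \<xi> \<eta> \<and> ((\<lambda>t. u t \<xi> \<eta>) \<longlongrightarrow> \<phi> \<xi> \<eta>) (at_left T))"

end

theory Submission
  imports Defs "HOL-Combinatorics.Cycles"
begin

text \<open>The market has a strategy that loses at most \<open>O(\<epsilon>\<^sup>3)\<close> per step against a small correction of \<open>u\<close>. Let
\<open>\<delta> m = q m - r m\<close>, let \<open>\<kappa>\<close> be half the quadratic form of the Hessian of \<open>u\<close> on the direction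
\<open>perp_grad u / u\<^sub>\<eta>\<close>, and let \<open>C\<close> be the value of the linear program, so that the equation reads
\<open>u\<^sub>t = - C \<kappa>\<close>. If the investor's choice \<open>f\<close> differs by \<open>g\<close> from the one that moves the regret vector
along the level set of \<open>u\<close>, then a move \<open>b\<close> of the market changes \<open>u\<close> to first order by
\<open>- 2 \<epsilon> b u\<^sub>\<eta> g\<close> and to second order, including the drift, by \<open>\<epsilon>\<^sup>2 \<kappa> ((\<delta> m)\<^sup>2 - C)\<close>, up to errors of size
\<open>\<epsilon>\<^sup>2 \<bar>g\<bar>\<close> and \<open>\<epsilon>\<^sup>3\<close>.\<close>

text \<open>The sign of the second-order change depends on the state, but the factor \<open>(\<delta> m)\<^sup>2 - C\<close> has mean zero over
the states, and the linear program makes this usable: there are multipliers \<open>\<beta>\<close> and a potential \<open>h\<close> on the states with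
\<open>(\<delta> m)\<^sup>2 - b * \<beta> m - C = h m - h (next_state m b)\<close> for both values of \<open>b\<close> (lemma \<open>ex_potential\<close>). Adding
the corrector \<open>\<epsilon>\<^sup>2 \<kappa> h\<close> to \<open>u\<close> therefore replaces the second-order change by \<open>\<epsilon>\<^sup>2 \<kappa> b (\<beta> m)\<close>, and the whole
change becomes \<open>b * (\<epsilon>\<^sup>2 \<kappa> \<beta> m - 2 \<epsilon> u\<^sub>\<eta> g)\<close>. The market makes it nonnegative by its choice of \<open>b\<close>; since
\<open>u\<^sub>\<eta> > c\<close>, a large \<open>g\<close> makes it large enough to pay for the error \<open>\<epsilon>\<^sup>2 \<bar>g\<bar>\<close>
(lemma \<open>market_move_beats_investor\<close>). So each step loses at most a multiple of \<open>\<epsilon>\<^sup>3\<close> (lemma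
\<open>one_step_ge\<close>), and \<open>(T - t) / \<epsilon>\<^sup>2\<close> steps lose a multiple of \<open>(T - t) \<epsilon>\<close>; the corrector at the two ends
accounts for the remaining \<open>\<epsilon>\<^sup>2\<close>.\<close>

text \<open>The potential exists for \<open>C\<close> exactly, because \<open>C\<close> is explicit: it is the mean of \<open>(\<delta> m)\<^sup>2\<close> over all states (lemma
\<open>lp_value_eq_mean\<close>). It is at least the mean since the walk driven by fair coin tosses is uniformly
distributed after \<open>d\<close> steps, which solves the Poisson equation for \<open>h\<close> by a finite sum; it is at most the
mean since the arcs of the de Bruijn graph are partitioned into simple cycles by two shift
registers. In particular \<open>C > 0\<close>, so that \<open>\<kappa> = - u\<^sub>t / C\<close> and the regularity of \<open>\<kappa>\<close> is that of \<open>u\<^sub>t\<close>.\<close>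

section \<open>Sums along closed orbits in the de Bruijn graph\<close>

lemma de_bruijn_simps:
  "verts (de_bruijn d) = states d" "arcs (de_bruijn d) = states d \<times> {1, -1}"
  "tail (de_bruijn d) (m, b) = m" "head (de_bruijn d) (m, b) = next_state m b"
  by (simp_all add: de_bruijn_def)

lemma orbit_is_walk:
  assumes step: "\<And>m. m \<in> states d \<Longrightarrow> \<sigma> m = next_state m (b m)"
    and closed: "\<And>m. m \<in> states d \<Longrightarrow> \<sigma> m \<in> states d"
    and "m \<in> states d"
  shows "pre_digraph.cas (de_bruijn d) m
           (map (\<lambda>i. ((\<sigma> ^^ i) m, b ((\<sigma> ^^ i) m))) [0..<n]) ((\<sigma> ^^ n) m)"
  using \<open>m \<in> states d\<close>
proof (induction n arbitrary: m)
  case 0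
  then show ?case by (simp add: pre_digraph.cas.simps)
next
  case (Suc n)
  have "pre_digraph.cas (de_bruijn d) (\<sigma> m)
      (map (\<lambda>i. ((\<sigma> ^^ i) (\<sigma> m), b ((\<sigma> ^^ i) (\<sigma> m)))) [0..<n]) ((\<sigma> ^^ n) (\<sigma> m))"
    using Suc.IH[OF closed[OF Suc.prems]] .
  then show ?case
    unfolding map_upt_Suc
    using step[OF Suc.prems]
    by (simp add: pre_digraph.cas.simps de_bruijn_simps funpow_swap1)
qed

text \<open>The constraints of the linear program speak only of simple cycles, but they imply the same bound
for every closed orbit of a permutation that moves along arcs: a closed orbit that revisits a state
splits there into two shorter closed orbits, and one that does not is a simple cycle.\<close>

lemma closed_orbit_sum_ge:
  assumes cyc: "\<And>s. pre_digraph.cycle (de_bruijn d) s \<Longrightarrow> (\<Sum>(m, b)\<leftarrow>s. w m b) \<ge> real (length s) * M"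
    and perm: "\<sigma> permutes states d"
    and step: "\<And>m. m \<in> states d \<Longrightarrow> \<sigma> m = next_state m (b m)"
    and b: "\<And>m. m \<in> states d \<Longrightarrow> b m \<in> {1, -1}"
    and m: "m \<in> states d"
    and "(\<sigma> ^^ n) m = m"
  shows "(\<Sum>i<n. w ((\<sigma> ^^ i) m) (b ((\<sigma> ^^ i) m))) \<ge> real n * M"
  using \<open>(\<sigma> ^^ n) m = m\<close>
proof (induction n rule: less_induct)
  case (less n)
  let ?F = "\<lambda>i. w ((\<sigma> ^^ i) m) (b ((\<sigma> ^^ i) m))"
  have in_states: "(\<sigma> ^^ i) m \<in> states d" for i
    using permutes_in_image[OF permutes_funpow[OF perm]] m by blast
  have inj: "inj (\<sigma> ^^ i)" for i
    using permutes_inj[OF permutes_funpow[OF perm]] .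
  show ?case
  proof (cases "n = 0 \<or> inj_on (\<lambda>i. (\<sigma> ^^ Suc i) m) {..<n}")
    case True
    show ?thesis
    proof (cases "n = 0")
      case False
      define s where "s = map (\<lambda>i. ((\<sigma> ^^ i) m, b ((\<sigma> ^^ i) m))) [0..<n]"
      have cas: "pre_digraph.cas (de_bruijn d) m s m"
        using orbit_is_walk[of d \<sigma> b m n, OF step _ m] permutes_in_image[OF perm] less.prems
        by (simp add: s_def)
      have "tl (pre_digraph.awalk_verts (de_bruijn d) m s) = map (\<lambda>i. (\<sigma> ^^ Suc i) m) [0..<n]"
        using False unfolding pre_digraph.awalk_verts_conv'[OF cas]
        by (simp add: s_def de_bruijn_simps step[OF in_states])
      moreover have "distinct (map (\<lambda>i. (\<sigma> ^^ Suc i) m) [0..<n])"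
        using True False by (simp add: distinct_map atLeast0LessThan del: funpow.simps)
      moreover have "set s \<subseteq> arcs (de_bruijn d)"
        using in_states b[OF in_states] by (auto simp: s_def de_bruijn_simps)
      ultimately have "pre_digraph.cycle (de_bruijn d) s"
        unfolding pre_digraph.cycle_def pre_digraph.awalk_def
        using cas m False by (intro exI[of _ m] conjI) (simp_all add: s_def de_bruijn_simps)
      from cyc[OF this] show ?thesis
        by (simp add: s_def interv_sum_list_conv_sum_set_nat o_def atLeast0LessThan)
    qed simp
  next
    case False
    then obtain i j where "i < j" "j < n" and eq: "(\<sigma> ^^ Suc i) m = (\<sigma> ^^ Suc j) m"
      unfolding inj_on_def by (metis lessThan_iff nat_neq_iff)
    \<comment> \<open>Injectivity of the iterates turns the repetition into a return to \<open>m\<close> itself after \<open>j - i\<close> steps.\<close>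
    define k where "k = j - i"
    have k: "0 < k" "k < n" and kn: "n - k < n" using \<open>i < j\<close> \<open>j < n\<close> by (auto simp: k_def)
    have "(\<sigma> ^^ Suc i) ((\<sigma> ^^ k) m) = (\<sigma> ^^ (Suc i + k)) m" by (metis comp_apply funpow_add)
    also have "Suc i + k = Suc j" using \<open>i < j\<close> by (simp add: k_def)
    finally have per: "(\<sigma> ^^ k) m = m"
      using injD[OF inj[of "Suc i"]] eq by metis
    have shift: "(\<sigma> ^^ (i + k)) m = (\<sigma> ^^ i) m" for i
      by (simp add: funpow_add per)
    have rest: "(\<sigma> ^^ (n - k)) m = m"
      using shift[of "n - k"] k less.prems by simp
    have "(\<Sum>i<n. ?F i) = (\<Sum>i<k. ?F i) + (\<Sum>i\<in>{k..<n}. ?F i)"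
      using k by (simp add: sum.atLeastLessThan_concat flip: atLeast0LessThan)
    also have "(\<Sum>i\<in>{k..<n}. ?F i) = (\<Sum>i<n - k. ?F (i + k))"
      using k sum.shift_bounds_nat_ivl[of ?F 0 k "n - k"] by (simp add: atLeast0LessThan)
    also have "\<dots> = (\<Sum>i<n - k. ?F i)" by (simp add: shift)
    finally have "(\<Sum>i<n. ?F i) = (\<Sum>i<k. ?F i) + (\<Sum>i<n - k. ?F i)" .
    moreover have "real n * M = real k * M + real (n - k) * M"
      using k by (simp add: of_nat_diff algebra_simps)
    ultimately show ?thesis
      using less.IH[OF k(2) per] less.IH[OF kn rest] by linarith
  qed
qed

lemma finite_states: "finite (states d)"
  using finite_lists_length_eq[of "UNIV :: bool set" d] by (simp add: states_def)

lemma card_states: "card (states d) = 2 ^ d"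
  using card_lists_length_eq[of "UNIV :: bool set" d] by (simp add: states_def)

text \<open>Some power \<open>\<sigma> ^^ n\<close> is the identity, so every state starts a closed orbit of length \<open>n\<close>, and in the
sum of all these orbits every state is visited exactly \<open>n\<close> times.\<close>

lemma sum_over_permutation_ge:
  assumes cyc: "\<And>s. pre_digraph.cycle (de_bruijn d) s \<Longrightarrow> (\<Sum>(m, b)\<leftarrow>s. w m b) \<ge> real (length s) * M"
    and perm: "\<sigma> permutes states d"
    and step: "\<And>m. m \<in> states d \<Longrightarrow> \<sigma> m = next_state m (b m)"
    and b: "\<And>m. m \<in> states d \<Longrightarrow> b m \<in> {1, -1}"
  shows "(\<Sum>m\<in>states d. w m (b m)) \<ge> 2 ^ d * M"
proof -
  obtain n where n: "\<sigma> ^^ n = id" "n > 0"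
    using permutation_is_nilpotent[OF permutes_imp_permutation[OF finite_states perm]] .
  have "(\<Sum>m\<in>states d. real n * M) \<le> (\<Sum>m\<in>states d. \<Sum>i<n. w ((\<sigma> ^^ i) m) (b ((\<sigma> ^^ i) m)))"
  proof (rule sum_mono)
    fix m assume m: "m \<in> states d"
    have "(\<sigma> ^^ n) m = m" using n by simp
    then show "real n * M \<le> (\<Sum>i<n. w ((\<sigma> ^^ i) m) (b ((\<sigma> ^^ i) m)))"
      using closed_orbit_sum_ge[where d = d and w = w and b = b and \<sigma> = \<sigma> and M = M, of m n]
        cyc perm step b m by blast
  qed
  also have "\<dots> = (\<Sum>i<n. \<Sum>m\<in>states d. w ((\<sigma> ^^ i) m) (b ((\<sigma> ^^ i) m)))"
    by (rule sum.swap)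
  also have "\<dots> = (\<Sum>i<n. \<Sum>m\<in>states d. w m (b m))"
    by (rule sum.cong[OF refl], rule sum.reindex_bij_betw[where g = "\<lambda>m. w m (b m)"],
        rule permutes_imp_bij[OF permutes_funpow[OF perm]])
  finally have "real n * (2 ^ d * M) \<le> real n * (\<Sum>m\<in>states d. w m (b m))"
    by (simp add: card_states mult.left_commute)
  then show ?thesis
    by (rule mult_left_le_imp_le) (use n in simp)
qed

section \<open>The value of the linear program\<close>

text \<open>The register with \<open>c = True\<close> rotates the state, the one with \<open>c = False\<close> rotates it and complements
the bit that wraps around. From each state the two leave along different arcs, so together their
orbits use every arc of the de Bruijn graph exactly once.\<close>

definition shift_register :: "nat \<Rightarrow> bool \<Rightarrow> bool list \<Rightarrow> bool list" where
  "shift_register d c m = (if m \<in> states d then tl m @ [hd m = c] else m)"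

lemma shift_register_permutes:
  assumes "d \<ge> 1"
  shows "shift_register d c permutes states d"
proof (rule inj_imp_permutes)
  show "inj_on (shift_register d c) (states d)"
  proof (rule inj_onI)
    fix x y assume xy: "x \<in> states d" "y \<in> states d"
      and "shift_register d c x = shift_register d c y"
    then have "tl x = tl y" and heads: "(hd x = c) = (hd y = c)"
      by (simp_all add: shift_register_def)
    have "hd x = hd y" using heads by argo
    have "x \<noteq> []" "y \<noteq> []" using xy assms by (auto simp: states_def)
    then show "x = y"
      using \<open>tl x = tl y\<close> \<open>hd x = hd y\<close> by (simp add: list.expand)
  qed
  show "shift_register d c m \<in> states d" if "m \<in> states d" for m
    using that assms by (simp add: shift_register_def states_def)
qed (simp_all add: shift_register_def finite_states)

text \<open>Summing the constraints along both shift registers uses every arc exactly once. The two arcs that leave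
\<open>m\<close> contribute \<open>- \<beta> m\<close> and \<open>\<beta> m\<close>, which cancel, and only the squares remain.\<close>

lemma lp_feasible_imp_le_mean:
  assumes "d \<ge> 1" and feas: "lp_feasible d q r \<beta> M"
  shows "M \<le> (\<Sum>m\<in>states d. (q m - r m)\<^sup>2) / 2 ^ d"
proof -
  define b :: "bool \<Rightarrow> bool list \<Rightarrow> real" where "b c m = (if hd m = c then 1 else -1)" for c m
  have cyc: "real (length s) * M \<le> (\<Sum>(m, b)\<leftarrow>s. (q m - r m)\<^sup>2 - b * \<beta> m)"
    if "pre_digraph.cycle (de_bruijn d) s" for s
    using feas that unfolding lp_feasible_def by blast
  have half: "(\<Sum>m\<in>states d. (q m - r m)\<^sup>2 - b c m * \<beta> m) \<ge> 2 ^ d * M" for c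
  proof (rule sum_over_permutation_ge[where w = "\<lambda>m b. (q m - r m)\<^sup>2 - b * \<beta> m"])
    show "shift_register d c permutes states d"
      by (rule shift_register_permutes[OF \<open>d \<ge> 1\<close>])
    show "shift_register d c m = next_state m (b c m)" if "m \<in> states d" for m
      using that by (simp add: shift_register_def next_state_def b_def)
    show "b c m \<in> {1, -1}" for m by (simp add: b_def)
    show "real (length s) * M \<le> (\<Sum>(m, b)\<leftarrow>s. (q m - r m)\<^sup>2 - b * \<beta> m)"
      if "pre_digraph.cycle (de_bruijn d) s" for s using that by (rule cyc)
  qed
  have "2 * (2 ^ d * M) \<le> (\<Sum>m\<in>states d. (q m - r m)\<^sup>2 - b True m * \<beta> m)
      + (\<Sum>m\<in>states d. (q m - r m)\<^sup>2 - b False m * \<beta> m)"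
    using half[of True] half[of False] by linarith
  also have "\<dots> = (\<Sum>m\<in>states d. 2 * (q m - r m)\<^sup>2)"
    unfolding sum.distrib[symmetric] by (intro sum.cong) (auto simp: b_def)
  also have "\<dots> = 2 * (\<Sum>m\<in>states d. (q m - r m)\<^sup>2)" by (simp add: sum_distrib_left)
  finally have "M * 2 ^ d \<le> (\<Sum>m\<in>states d. (q m - r m)\<^sup>2)"
    by (simp add: mult.commute)
  then show ?thesis by (simp add: pos_le_divide_eq)
qed

definition mean_next :: "(bool list \<Rightarrow> real) \<Rightarrow> bool list \<Rightarrow> real" where
  "mean_next g m = (g (next_state m 1) + g (next_state m (-1))) / 2"

text \<open>\<open>mean_next\<close> is the transition operator of the walk that is driven by fair coin tosses. After \<open>k\<close> tosses
the \<open>k\<close> oldest bits of the state have been replaced by uniformly distributed ones.\<close>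

lemma mean_next_funpow:
  assumes "k \<le> length m"
  shows "(mean_next ^^ k) g m = (\<Sum>w\<in>states k. g (drop k m @ w)) / 2 ^ k"
  using assms
proof (induction k arbitrary: m)
  case 0
  have "states 0 = {[]}" by (auto simp: states_def)
  then show ?case by simp
next
  case (Suc k)
  have split: "states (Suc k) = (#) True ` states k \<union> (#) False ` states k"
    by (auto simp: states_def length_Suc_conv)
  have sum_split: "(\<Sum>w\<in>states (Suc k). g (drop (Suc k) m @ w))
      = (\<Sum>w\<in>states k. g (drop (Suc k) m @ True # w)) + (\<Sum>w\<in>states k. g (drop (Suc k) m @ False # w))"
    unfolding split
    by (subst sum.union_disjoint) (auto simp: finite_states sum.reindex)
  have drop: "drop k (next_state m b) = drop (Suc k) m @ [b = 1]" for b
    using Suc.prems by (simp add: next_state_def drop_Suc)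
  have IH: "(mean_next ^^ k) g (next_state m b)
      = (\<Sum>w\<in>states k. g (drop (Suc k) m @ (b = 1) # w)) / 2 ^ k" for b
    using Suc.IH[of "next_state m b"] Suc.prems by (simp add: drop) (simp add: next_state_def)
  have "(mean_next ^^ Suc k) g m
      = ((mean_next ^^ k) g (next_state m 1) + (mean_next ^^ k) g (next_state m (-1))) / 2"
    by (simp add: mean_next_def)
  then show ?case
    unfolding IH sum_split by (simp add: add_divide_distrib)
qed

text \<open>The walk driven by fair coin tosses is uniformly distributed after exactly \<open>d\<close> steps, so the finite sum
\<open>h\<close> of the first \<open>d\<close> iterates of \<open>mean_next\<close> on \<open>g\<close> solves the Poisson equation: \<open>h\<close> minus its mean
over the two successors equals \<open>g\<close> minus its mean over all states. This is the required identity
averaged over the two values of \<open>b\<close>; taking half the difference of \<open>h\<close> at the successors for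
\<open>\<beta>\<close> makes it hold for each value.\<close>

lemma ex_potential:
  obtains h :: "bool list \<Rightarrow> real" and \<beta> :: "bool list \<Rightarrow> real"
  where "\<And>m b. m \<in> states d \<Longrightarrow> b \<in> {1, -1} \<Longrightarrow>
    g m - b * \<beta> m - (\<Sum>m\<in>states d. g m) / 2 ^ d = h m - h (next_state m b)"
proof -
  define h where "h m = (\<Sum>k<d. (mean_next ^^ k) g m)" for m
  define \<beta> where "\<beta> m = (h (next_state m 1) - h (next_state m (-1))) / 2" for m
  have "h m - (h (next_state m 1) + h (next_state m (-1))) / 2 = g m - (\<Sum>m\<in>states d. g m) / 2 ^ d"
    if "m \<in> states d" for m
  proof -
    have "(h (next_state m 1) + h (next_state m (-1))) / 2 = (\<Sum>k<d. (mean_next ^^ Suc k) g m)"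
      by (simp add: h_def mean_next_def sum.distrib flip: sum_divide_distrib)
    then have "h m - (h (next_state m 1) + h (next_state m (-1))) / 2
        = (\<Sum>k<d. (mean_next ^^ k) g m - (mean_next ^^ Suc k) g m)"
      by (simp add: h_def sum_subtractf)
    also have "\<dots> = g m - (mean_next ^^ d) g m"
      by (subst sum_lessThan_telescope') simp
    also have "(mean_next ^^ d) g m = (\<Sum>m\<in>states d. g m) / 2 ^ d"
      using that by (simp add: mean_next_funpow states_def)
    finally show ?thesis .
  qed
  note poisson = this
  show ?thesis
  proof (rule that[of \<beta> h])
    fix m b assume "m \<in> states d" "b \<in> {1, -1 :: real}"
    then show "g m - b * \<beta> m - (\<Sum>m\<in>states d. g m) / 2 ^ d = h m - h (next_state m b)"
      using poisson[of m] unfolding \<beta>_def by (auto simp: field_simps)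
  qed
qed

lemma walk_sum_potential:
  assumes "\<And>m b. m \<in> states d \<Longrightarrow> b \<in> {1, -1} \<Longrightarrow> w m b - M = h m - h (next_state m b)"
    and "set s \<subseteq> arcs (de_bruijn d)" "pre_digraph.cas (de_bruijn d) u s v"
  shows "(\<Sum>(m, b)\<leftarrow>s. w m b) = real (length s) * M + h u - h v"
  using assms(2,3)
proof (induction s arbitrary: u)
  case Nil
  then show ?case by (simp add: pre_digraph.cas.simps)
next
  case (Cons e s)
  obtain m b where e: "e = (m, b)" by (cases e)
  have arc: "m \<in> states d" "b \<in> {1, -1}" and "u = m"
    and "set s \<subseteq> arcs (de_bruijn d)" "pre_digraph.cas (de_bruijn d) (next_state m b) s v"
    using Cons.prems unfolding e pre_digraph.cas.simps by (auto simp: de_bruijn_simps)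
  then have "(\<Sum>(m, b)\<leftarrow>s. w m b) = real (length s) * M + h (next_state m b) - h v"
    by (intro Cons.IH)
  moreover have "w m b - M = h m - h (next_state m b)"
    using arc by (rule assms(1))
  ultimately show ?case
    using \<open>u = m\<close> by (simp add: e distrib_right)
qed

text \<open>The multipliers of \<open>ex_potential\<close> attain the upper bound, because along a closed walk the potential
differences telescope to zero.\<close>

theorem lp_value_eq_mean:
  assumes "d \<ge> 1"
  shows "lp_value d q r = (\<Sum>m\<in>states d. (q m - r m)\<^sup>2) / 2 ^ d"
  unfolding lp_value_def
proof (rule cSup_eq_maximum)
  let ?M = "(\<Sum>m\<in>states d. (q m - r m)\<^sup>2) / 2 ^ d"
  obtain h \<beta> where *: "\<And>m b. m \<in> states d \<Longrightarrow> b \<in> {1, -1} \<Longrightarrow>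
      (q m - r m)\<^sup>2 - b * \<beta> m - ?M = h m - h (next_state m b)"
    by (rule ex_potential[of d "\<lambda>m. (q m - r m)\<^sup>2"]) (rule that)
  have "lp_feasible d q r \<beta> ?M"
    unfolding lp_feasible_def
  proof (intro allI impI)
    fix s assume "pre_digraph.cycle (de_bruijn d) s"
    then obtain u where "set s \<subseteq> arcs (de_bruijn d)" "pre_digraph.cas (de_bruijn d) u s u"
      unfolding pre_digraph.cycle_def pre_digraph.awalk_def by blast
    then have "(\<Sum>(m, b)\<leftarrow>s. (q m - r m)\<^sup>2 - b * \<beta> m) = real (length s) * ?M + h u - h u"
      by (rule walk_sum_potential[where w = "\<lambda>m b. (q m - r m)\<^sup>2 - b * \<beta> m", rotated]) (rule *)
    then show "real (length s) * ?M \<le> (\<Sum>(m, b)\<leftarrow>s. (q m - r m)\<^sup>2 - b * \<beta> m)" by simp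
  qed
  then show "?M \<in> {M. \<exists>\<beta>. lp_feasible d q r \<beta> M}" by blast
next
  fix x assume "x \<in> {M. \<exists>\<beta>. lp_feasible d q r \<beta> M}"
  then obtain \<beta> where "lp_feasible d q r \<beta> x" by blast
  then show "x \<le> (\<Sum>m\<in>states d. (q m - r m)\<^sup>2) / 2 ^ d"
    by (rule lp_feasible_imp_le_mean[OF assms])
qed


section \<open>Taylor bounds from bounded partial derivatives\<close>

lemma has_derivative_from_partials:
  fixes g gx gy :: "real \<Rightarrow> real \<Rightarrow> real"
  assumes x: "\<And>x y. ((\<lambda>x. g x y) has_real_derivative gx x y) (at x)"
    and y: "\<And>x y. ((\<lambda>y. g x y) has_real_derivative gy x y) (at y)"
    and cont: "continuous_on UNIV (\<lambda>(x, y). gy x y)"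
  shows "((\<lambda>(x, y). g x y) has_derivative (\<lambda>(a, b). gx x y * a + gy x y * b)) (at (x, y))"
proof -
  have "((\<lambda>(x, y). g x y) has_derivative
      (\<lambda>(a, b). gx x y * a + blinfun_mult_right (gy x y) b)) (at (x, y) within UNIV \<times> UNIV)"
  proof (rule has_derivative_partialsI[where fy = "\<lambda>x y. blinfun_mult_right (gy x y)"])
    show "((\<lambda>x. g x y) has_derivative (*) (gx x y)) (at x)"
      using x unfolding has_field_derivative_def .
    show "((\<lambda>y. g x y) has_derivative blinfun_apply (blinfun_mult_right (gy x y))) (at y)" for x y
      using y unfolding has_field_derivative_def by simp
    have "isCont (\<lambda>p. blinfun_mult_right ((\<lambda>(x, y). gy x y) p)) (x, y)"
      using cont by (intro bounded_linear.isCont[OF bounded_linear_blinfun_mult_right])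
        (simp add: continuous_on_eq_continuous_at)
    then show "continuous (at (x, y) within UNIV \<times> UNIV) (\<lambda>(x, y). blinfun_mult_right (gy x y))"
      by (simp add: case_prod_unfold)
  qed auto
  then show ?thesis by simp
qed

lemma space_differentiableD:
  assumes "space_differentiable T g" "t < T"
  shows "((\<lambda>x. g t x \<eta>) has_real_derivative Dxi g t \<xi> \<eta>) (at \<xi>)"
    and "((\<lambda>y. g t \<xi> y) has_real_derivative Deta g t \<xi> \<eta>) (at \<eta>)"
  using assms unfolding space_differentiable_def Dxi_def Deta_def
  by (auto simp: DERIV_deriv_iff_real_differentiable)

lemma directional_derivative:
  assumes g: "space_differentiable T g" "cont_bounded T K (Deta g)" and t: "t < T"
  shows "((\<lambda>s. g t (\<xi> + s * a) (\<eta> + s * b)) has_real_derivative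
     Dxi g t (\<xi> + s * a) (\<eta> + s * b) * a + Deta g t (\<xi> + s * a) (\<eta> + s * b) * b) (at s)"
proof -
  have "continuous_on UNIV (\<lambda>p. (\<lambda>(t, \<xi>, \<eta>). Deta g t \<xi> \<eta>) (t, p))"
    using g(2) t unfolding cont_bounded_def
    by (intro continuous_on_compose2[where f = "\<lambda>p. (t, p)" and g = "\<lambda>(t, \<xi>, \<eta>). Deta g t \<xi> \<eta>"])
      (auto intro!: continuous_intros)
  then have cont: "continuous_on UNIV (\<lambda>(\<xi>, \<eta>). Deta g t \<xi> \<eta>)"
    by (simp add: case_prod_unfold)
  have "((\<lambda>s. (\<lambda>(x, y). g t x y) (\<xi> + s * a, \<eta> + s * b)) has_derivative
      (\<lambda>h. (\<lambda>(a', b'). Dxi g t (\<xi> + s * a) (\<eta> + s * b) * a' + Deta g t (\<xi> + s * a) (\<eta> + s * b) * b')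
         (h * a, h * b))) (at s)"
  proof (rule has_derivative_compose[where f = "\<lambda>s. (\<xi> + s * a, \<eta> + s * b)" and f' = "\<lambda>h. (h * a, h * b)"
        and g' = "\<lambda>(a', b'). Dxi g t (\<xi> + s * a) (\<eta> + s * b) * a' + Deta g t (\<xi> + s * a) (\<eta> + s * b) * b'"])
    show "((\<lambda>s. (\<xi> + s * a, \<eta> + s * b)) has_derivative (\<lambda>h. (h * a, h * b))) (at s)"
      by (auto intro!: derivative_eq_intros)
  qed (use has_derivative_from_partials[OF space_differentiableD[OF g(1) t] cont] in simp)
  then show ?thesis
    unfolding has_field_derivative_def prod.case
    by (rule has_derivative_eq_rhs) (auto simp: algebra_simps fun_eq_iff)
qed

lemma space_lipschitz:
  assumes g: "space_differentiable T g" "cont_bounded T K (Dxi g)" "cont_bounded T K (Deta g)"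
    and t: "t < T"
  shows "\<bar>g t (\<xi> + a) (\<eta> + b) - g t \<xi> \<eta>\<bar> \<le> K * (\<bar>a\<bar> + \<bar>b\<bar>)"
proof -
  let ?G = "\<lambda>s. g t (\<xi> + s * a) (\<eta> + s * b)"
  have "\<exists>s::real. 0 < s \<and> s < 1 \<and> ?G 1 - ?G 0 = (1 - 0) *
     (Dxi g t (\<xi> + s * a) (\<eta> + s * b) * a + Deta g t (\<xi> + s * a) (\<eta> + s * b) * b)"
    by (rule MVT2) (auto intro: directional_derivative[OF g(1,3) t])
  then obtain s where s: "?G 1 - ?G 0 =
     Dxi g t (\<xi> + s * a) (\<eta> + s * b) * a + Deta g t (\<xi> + s * a) (\<eta> + s * b) * b"
    by auto
  have "\<bar>Dxi g t x y * a\<bar> \<le> K * \<bar>a\<bar>" "\<bar>Deta g t x y * b\<bar> \<le> K * \<bar>b\<bar>" for x y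
    using g(2,3) t by (auto simp: cont_bounded_def abs_mult intro!: mult_right_mono)
  then have "\<bar>?G 1 - ?G 0\<bar> \<le> K * \<bar>a\<bar> + K * \<bar>b\<bar>"
    unfolding s by (meson abs_triangle_ineq add_mono order_trans)
  then show ?thesis by (simp add: algebra_simps)
qed

lemma time_lipschitz:
  assumes g: "t_differentiable T g" "\<And>s. s < T \<Longrightarrow> \<bar>Dt g s \<xi> \<eta>\<bar> \<le> K" and t: "t \<le> t'" "t' < T"
  shows "\<bar>g t' \<xi> \<eta> - g t \<xi> \<eta>\<bar> \<le> K * (t' - t)"
proof (cases "t = t'")
  case False
  have "((\<lambda>s. g s \<xi> \<eta>) has_real_derivative Dt g s \<xi> \<eta>) (at s)" if "s < T" for s
    using g(1) that unfolding t_differentiable_def Dt_def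
    by (auto simp: DERIV_deriv_iff_real_differentiable)
  then have "\<exists>s>t. s < t' \<and> g t' \<xi> \<eta> - g t \<xi> \<eta> = (t' - t) * Dt g s \<xi> \<eta>"
    using False t by (intro MVT2) auto
  then obtain s where "s < t'" "g t' \<xi> \<eta> - g t \<xi> \<eta> = (t' - t) * Dt g s \<xi> \<eta>" by blast
  then show ?thesis
    using g(2)[of s] t by (auto simp: abs_mult mult.commute[of K] intro!: mult_left_mono)
qed simp

lemma time_taylor:
  assumes g: "t_differentiable T g" "t_differentiable T (Dt g)" "cont_bounded T K (Dt (Dt g))"
    and t: "t < t'" "t' < T"
  shows "g t' \<xi> \<eta> \<ge> g t \<xi> \<eta> + (t' - t) * Dt g t \<xi> \<eta> - K * (t' - t)\<^sup>2"
proof -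
  have "((\<lambda>s. g s \<xi> \<eta>) has_real_derivative Dt g s \<xi> \<eta>) (at s)" if "s < T" for s
    using g(1) that unfolding t_differentiable_def Dt_def
    by (auto simp: DERIV_deriv_iff_real_differentiable)
  then have "\<exists>s>t. s < t' \<and> g t' \<xi> \<eta> - g t \<xi> \<eta> = (t' - t) * Dt g s \<xi> \<eta>"
    using t by (intro MVT2) auto
  then obtain s where s: "t < s" "s < t'" "g t' \<xi> \<eta> - g t \<xi> \<eta> = (t' - t) * Dt g s \<xi> \<eta>" by blast
  have K: "K \<ge> 0" and bd: "\<bar>Dt (Dt g) s \<xi> \<eta>\<bar> \<le> K" if "s < T" for s
    using g(3) that unfolding cont_bounded_def by force+
  have "\<bar>Dt g s \<xi> \<eta> - Dt g t \<xi> \<eta>\<bar> \<le> K * (s - t)"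
    using time_lipschitz[OF g(2) bd, of t s] s t by simp
  also have "\<dots> \<le> K * (t' - t)" using K[of t] s t by (intro mult_left_mono) auto
  finally have "Dt g s \<xi> \<eta> \<ge> Dt g t \<xi> \<eta> - K * (t' - t)" by linarith
  then have "(t' - t) * Dt g s \<xi> \<eta> \<ge> (t' - t) * (Dt g t \<xi> \<eta> - K * (t' - t))"
    using t by (intro mult_left_mono) auto
  then show ?thesis using s by (simp add: algebra_simps power2_eq_square)
qed

text \<open>Expanding \<open>u\<close> along the segment from \<open>(\<xi>, \<eta>)\<close> to \<open>(\<xi> + a, \<eta> + b)\<close> with a second-order remainder yields
the quadratic form of \<open>hessian\<close> at an intermediate point. Its entries are Lipschitz, since the third derivatives are bounded;
replacing the intermediate point by \<open>(\<xi>, \<eta>)\<close> therefore costs a cubic error.\<close>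

lemma space_taylor:
  fixes u t \<xi> \<eta> a b
  defines "H \<equiv> hessian u t \<xi> \<eta> (a, b) \<bullet> (a, b)"
  assumes u: "space_differentiable T u" "space_CB 2 T K (Dxi u)" "space_CB 2 T K (Deta u)"
    and t: "t < T"
  shows "u t (\<xi> + a) (\<eta> + b) \<ge> u t \<xi> \<eta> + (Dxi u t \<xi> \<eta> * a + Deta u t \<xi> \<eta> * b) + H / 2
           - K * (\<bar>a\<bar> + \<bar>b\<bar>) ^ 3"
proof -
  let ?X = "\<lambda>s. \<xi> + s * a" and ?Y = "\<lambda>s. \<eta> + s * b"
  let ?Q = "\<lambda>x y. hessian u t x y (a, b) \<bullet> (a, b)"
  \<comment> \<open>\<open>u\<close> along the segment and its first two derivatives there\<close>
  define G where "G m s = (if m = 0 then u t (?X s) (?Y s)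
      else if m = 1 then Dxi u t (?X s) (?Y s) * a + Deta u t (?X s) (?Y s) * b
      else ?Q (?X s) (?Y s))" for m :: nat and s
  have d: "space_differentiable T (Dxi u)" "space_differentiable T (Deta u)"
    and cb: "cont_bounded T K (Deta u)" "cont_bounded T K (Deta (Dxi u))" "cont_bounded T K (Deta (Deta u))"
    using u by (auto simp: numeral_2_eq_2)
  have "(G 0 has_real_derivative G 1 s) (at s)" for s
    unfolding G_def using directional_derivative[OF u(1) cb(1) t] by simp
  moreover have "(G 1 has_real_derivative G 2 s) (at s)" for s
    unfolding G_def hessian_def
    by (auto intro!: derivative_eq_intros directional_derivative[OF d(1) cb(2) t]
        directional_derivative[OF d(2) cb(3) t])
  ultimately have "(G m has_real_derivative G (Suc m) s) (at s)" if "m < 2" for m s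
    using that less_2_cases[of m] by (auto simp: numeral_2_eq_2)
  then have "\<exists>s::real. 0 < s \<and> s < 1 \<and>
      G 0 1 = (\<Sum>m<2. G m 0 / fact m * 1 ^ m) + G 2 s / fact 2 * 1 ^ 2"
    by (intro Maclaurin) auto
  then obtain s where s: "0 < s" "s < 1" "G 0 1 = G 0 0 + G 1 0 + G 2 s / 2"
    by (auto simp: numeral_2_eq_2)
  let ?n = "\<bar>a\<bar> + \<bar>b\<bar>"
  have K: "K \<ge> 0" using cb(1) t unfolding cont_bounded_def by force
  have lip: "\<bar>g t (?X s) (?Y s) - g t \<xi> \<eta>\<bar> \<le> K * ?n"
    if "space_differentiable T g" "cont_bounded T K (Dxi g)" "cont_bounded T K (Deta g)" for g
  proof -
    have "\<bar>g t (?X s) (?Y s) - g t \<xi> \<eta>\<bar> \<le> K * (\<bar>s * a\<bar> + \<bar>s * b\<bar>)"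
      by (rule space_lipschitz[OF that t])
    also have "\<dots> = s * (K * ?n)" using s by (simp add: abs_mult algebra_simps)
    also have "\<dots> \<le> 1 * (K * ?n)" using s K by (intro mult_right_mono) auto
    finally show ?thesis by simp
  qed
  have prod: "\<bar>(v - w) * e\<bar> \<le> K * ?n * \<bar>e\<bar>" if "\<bar>v - w\<bar> \<le> K * ?n" for v w e :: real
    using that by (simp add: abs_mult mult_right_mono)
  have "\<bar>G 2 s - ?Q \<xi> \<eta>\<bar> \<le> K * ?n * \<bar>a * a\<bar> + K * ?n * \<bar>b * a\<bar> + K * ?n * \<bar>a * b\<bar> + K * ?n * \<bar>b * b\<bar>"
  proof -
    have "G 2 s - ?Q \<xi> \<eta> =
        (Dxi (Dxi u) t (?X s) (?Y s) - Dxi (Dxi u) t \<xi> \<eta>) * (a * a)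
      + (Deta (Dxi u) t (?X s) (?Y s) - Deta (Dxi u) t \<xi> \<eta>) * (b * a)
      + (Dxi (Deta u) t (?X s) (?Y s) - Dxi (Deta u) t \<xi> \<eta>) * (a * b)
      + (Deta (Deta u) t (?X s) (?Y s) - Deta (Deta u) t \<xi> \<eta>) * (b * b)"
      by (simp add: G_def hessian_def algebra_simps)
    also have "\<bar>\<dots>\<bar> \<le> K * ?n * \<bar>a * a\<bar> + K * ?n * \<bar>b * a\<bar> + K * ?n * \<bar>a * b\<bar> + K * ?n * \<bar>b * b\<bar>"
      using u by (intro order_trans[OF abs_triangle_ineq] add_mono prod lip) (auto simp: numeral_2_eq_2)
    finally show ?thesis .
  qed
  also have "\<dots> = K * ?n ^ 3"
    by (simp add: abs_mult algebra_simps power3_eq_cube)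
  finally have "G 2 s / 2 \<ge> H / 2 - K * ?n ^ 3 / 2" unfolding H_def by linarith
  moreover have "K * ?n ^ 3 \<ge> 0" using K by simp
  ultimately show ?thesis using s(3) by (simp add: G_def)
qed


section \<open>One step of the game\<close>

text \<open>Here \<open>g\<close> is the deviation of the investor from the choice that keeps the regret vector on the level set
of the solution, \<open>p\<close> is \<open>u\<^sub>\<eta>\<close>, and \<open>\<theta>\<close> the contribution of the market's multiplier. The market picks \<open>b\<close>
to make \<open>b * X\<close> equal to \<open>\<bar>X\<bar>\<close>, where \<open>X\<close> is the bracket. A deviation \<open>g\<close> then also perturbs the
second-order term, by \<open>10 K \<epsilon>\<^sup>2 \<bar>g\<bar>\<close>; but if \<open>g\<close> is large, then so is \<open>X\<close>, of size \<open>\<epsilon> \<bar>g\<bar>\<close>, and it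
absorbs this loss up to an error of order \<open>\<epsilon>\<^sup>3\<close>.\<close>

lemma market_move_beats_investor:
  fixes g \<theta> :: real
  assumes "0 \<le> K" "0 < c" "0 < \<epsilon>" "5 * K * \<epsilon> \<le> c" "c \<le> p" "\<bar>\<theta>\<bar> \<le> L"
  shows "\<exists>b\<in>{1, -1}. b * (\<epsilon>\<^sup>2 * \<theta> - 2 * \<epsilon> * p * g) - 10 * K * \<epsilon>\<^sup>2 * \<bar>g\<bar> \<ge> - (5 * K * L / c * \<epsilon> ^ 3)"
proof -
  let ?X = "\<epsilon>\<^sup>2 * \<theta> - 2 * \<epsilon> * p * g"
  define \<rho> where "\<rho> = 5 * K * \<epsilon> / c"
  have \<rho>: "0 \<le> \<rho>" "\<rho> \<le> 1" using assms by (auto simp: \<rho>_def)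
  have "2 * \<epsilon> * c * \<bar>g\<bar> \<le> 2 * \<epsilon> * p * \<bar>g\<bar>"
    using assms by (intro mult_right_mono mult_left_mono) auto
  also have "\<dots> = \<bar>2 * \<epsilon> * p * g\<bar>" using assms by (simp add: abs_mult)
  also have "\<dots> \<le> \<bar>?X\<bar> + \<epsilon>\<^sup>2 * \<bar>\<theta>\<bar>"
    using abs_triangle_ineq4[of "\<epsilon>\<^sup>2 * \<theta>" ?X] by (simp add: abs_mult)
  also have "\<dots> \<le> \<bar>?X\<bar> + \<epsilon>\<^sup>2 * L"
    using assms by (intro add_left_mono mult_left_mono) auto
  finally have "\<rho> * (2 * \<epsilon> * c * \<bar>g\<bar>) \<le> \<rho> * (\<bar>?X\<bar> + \<epsilon>\<^sup>2 * L)"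
    using \<rho> by (intro mult_left_mono)
  moreover have "\<rho> * (2 * \<epsilon> * c * \<bar>g\<bar>) = 10 * K * \<epsilon>\<^sup>2 * \<bar>g\<bar>"
    using assms by (simp add: \<rho>_def power2_eq_square)
  moreover have "\<rho> * \<bar>?X\<bar> \<le> 1 * \<bar>?X\<bar>" using \<rho> by (intro mult_right_mono) auto
  moreover have "\<rho> * (\<epsilon>\<^sup>2 * L) = 5 * K * L / c * \<epsilon> ^ 3"
    by (simp add: \<rho>_def power2_eq_square power3_eq_cube)
  ultimately have "\<bar>?X\<bar> - 10 * K * \<epsilon>\<^sup>2 * \<bar>g\<bar> \<ge> - (5 * K * L / c * \<epsilon> ^ 3)"
    by (simp add: distrib_left)
  then show ?thesis by (cases "?X \<ge> 0") auto
qed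

text \<open>For \<open>e = - \<delta> p\<close>, where \<open>p\<close> is \<open>u\<^sub>\<xi> / u\<^sub>\<eta>\<close>, the displacement \<open>(\<delta>, e)\<close> is tangent to the level set and the
quadratic form is \<open>\<delta>\<^sup>2\<close> times the one in the equation. The difference of the two forms has
the factor \<open>e + \<delta> p\<close>, hence is at most linear in the deviation from tangency.\<close>

lemma quadratic_form_near_level_set:
  fixes hxx hxy hyx hyy \<delta> e p :: real
  assumes "\<bar>hxy\<bar> \<le> K" "\<bar>hyx\<bar> \<le> K" "\<bar>hyy\<bar> \<le> K" "\<bar>\<delta>\<bar> \<le> 2" "\<bar>e\<bar> \<le> 4" "\<bar>p\<bar> \<le> 1"
  shows "(\<delta>\<^sup>2 * hxx + \<delta> * e * (hxy + hyx) + e\<^sup>2 * hyy) / 2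
      \<ge> \<delta>\<^sup>2 * ((hxx - p * (hxy + hyx) + p\<^sup>2 * hyy) / 2) - 10 * K * \<bar>(e + \<delta> * p) / 2\<bar>"
proof -
  let ?g = "(e + \<delta> * p) / 2" and ?r = "(hxy + hyx) * \<delta> + hyy * (e - \<delta> * p)"
  have "K \<ge> 0" using assms(1) by linarith
  have "\<bar>\<delta> * p\<bar> \<le> 2 * 1"
    unfolding abs_mult using assms by (intro mult_mono) auto
  then have "\<bar>e - \<delta> * p\<bar> \<le> 6" using assms(5) by linarith
  then have "\<bar>hyy * (e - \<delta> * p)\<bar> \<le> K * 6"
    unfolding abs_mult using assms \<open>K \<ge> 0\<close> by (intro mult_mono) auto
  moreover have "\<bar>(hxy + hyx) * \<delta>\<bar> \<le> (2 * K) * 2"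
    unfolding abs_mult using assms \<open>K \<ge> 0\<close> by (intro mult_mono) auto
  ultimately have "\<bar>?r\<bar> \<le> 10 * K" by linarith
  then have "\<bar>?g * ?r\<bar> \<le> \<bar>?g\<bar> * (10 * K)"
    unfolding abs_mult by (intro mult_left_mono) auto
  moreover have "(\<delta>\<^sup>2 * hxx + \<delta> * e * (hxy + hyx) + e\<^sup>2 * hyy) / 2
      = \<delta>\<^sup>2 * ((hxx - p * (hxy + hyx) + p\<^sup>2 * hyy) / 2) + ?g * ?r"
    by (simp add: field_simps power2_eq_square)
  ultimately show ?thesis by (simp add: mult.commute)
qed

text \<open>The solution \<open>u\<close> itself does not improve in every single step, since the drift of the equation matches the
second-order term only on average over the states. The corrector of order \<open>\<epsilon>\<^sup>2\<close> compensates for this. Its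
factor \<open>- Dt u / C\<close> equals half the quadratic form of the Hessian in the equation; written through \<open>Dt u\<close>
it inherits a Lipschitz bound in space and time directly from the regularity of the time derivatives.\<close>

definition corrected ::
  "real \<Rightarrow> (bool list \<Rightarrow> real) \<Rightarrow> real \<Rightarrow> (real \<Rightarrow> real \<Rightarrow> real \<Rightarrow> real)
    \<Rightarrow> real \<Rightarrow> bool list \<Rightarrow> real \<Rightarrow> real \<Rightarrow> real" where
  "corrected C h \<epsilon> u t m \<xi> \<eta> = u t \<xi> \<eta> + \<epsilon>\<^sup>2 * (- Dt u t \<xi> \<eta> / C) * h m"

lemma regular_with_boundD:
  assumes "regular_with_bound T K u"
  shows "space_differentiable T u" "space_CB 2 T K (Dxi u)" "space_CB 2 T K (Deta u)"
    and "t_differentiable T u" "t_differentiable T (Dt u)" "cont_bounded T K (Dt (Dt u))"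
    and "space_differentiable T (Dt u)" "cont_bounded T K (Dt u)"
    and "cont_bounded T K (Dxi (Dt u))" "cont_bounded T K (Deta (Dt u))"
  using assms by (auto simp: regular_with_bound_def numeral_2_eq_2 numeral_3_eq_3)

text \<open>Expand \<open>corrected\<close> over one step, with \<open>\<delta> = q m - r m\<close> and \<open>\<kappa> = - Dt u / C\<close>. The terms of order \<open>\<epsilon>\<^sup>2\<close> are
\<open>\<kappa>\<close> times \<open>\<delta>\<^sup>2\<close> (second-order term), \<open>- C\<close> (drift) and \<open>h (next_state m b) - h m\<close> (corrector); by the choice of the
potential they add up to \<open>b * \<beta> m\<close>. Together with the first-order term this is \<open>b\<close> times one bracket, so
\<open>market_move_beats_investor\<close> gives the market's reply. All remaining errors are of order \<open>\<epsilon>\<^sup>3\<close>.\<close>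

lemma one_step_ge:
  fixes u :: "real \<Rightarrow> real \<Rightarrow> real \<Rightarrow> real"
  assumes pde: "solves_pde C T \<phi> u" and reg: "regular_with_bound T K u"
    and grad: "\<And>t \<xi> \<eta>. t < T \<Longrightarrow> Deta u t \<xi> \<eta> > c"
      "\<And>t \<xi> \<eta>. t < T \<Longrightarrow> \<bar>Dxi u t \<xi> \<eta>\<bar> \<le> Deta u t \<xi> \<eta>"
    and "C > 0" "c > 0"
    and pot: "\<And>b. b \<in> {1, -1} \<Longrightarrow> (q m - r m)\<^sup>2 - b * \<beta> m - C = h m - h (next_state m b)"
    and hB: "\<And>b. \<bar>h (next_state m b)\<bar> \<le> B" and \<beta>B: "\<bar>\<beta> m\<bar> \<le> B"
    and qr: "\<bar>q m\<bar> < 1" "\<bar>r m\<bar> < 1" and f: "\<bar>f\<bar> \<le> 1"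
    and \<epsilon>: "0 < \<epsilon>" "\<epsilon> \<le> 1" "5 * K * \<epsilon> \<le> c" and s: "s + \<epsilon>\<^sup>2 < T"
  shows "\<exists>b\<in>{1, -1}.
     corrected C h \<epsilon> u (s + \<epsilon>\<^sup>2) (next_state m b)
       (\<xi> + \<epsilon> * b * (q m - r m)) (\<eta> + \<epsilon> * b * (q m + r m - 2 * f))
     \<ge> corrected C h \<epsilon> u s m \<xi> \<eta> - (223 * K + 7 * K * B / C + 5 * K * (K / C * B) / c) * \<epsilon> ^ 3"
proof -
  note reg' = regular_with_boundD[OF reg]
  have "\<epsilon>\<^sup>2 > 0" using \<epsilon> by simp
  then have "s < T" using s by linarith
  have bd: "\<bar>Dt u t x y\<bar> \<le> K" "\<bar>Deta (Dxi u) t x y\<bar> \<le> K" "\<bar>Dxi (Deta u) t x y\<bar> \<le> K"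
    "\<bar>Deta (Deta u) t x y\<bar> \<le> K" "\<bar>Dt (Dt u) t x y\<bar> \<le> K" if "t < T" for t x y
    using reg'(2,3,6,8) that by (auto simp: numeral_2_eq_2 cont_bounded_def)
  have K: "K \<ge> 0" using bd(1)[OF \<open>s < T\<close>, of 0 0] by linarith
  define \<delta> where "\<delta> = q m - r m"
  define e where "e = q m + r m - 2 * f"
  define ue where "ue = Deta u s \<xi> \<eta>"
  define p where "p = Dxi u s \<xi> \<eta> / ue"
  define hxx where "hxx = Dxi (Dxi u) s \<xi> \<eta>"
  define hxy where "hxy = Deta (Dxi u) s \<xi> \<eta>"
  define hyx where "hyx = Dxi (Deta u) s \<xi> \<eta>"
  define hyy where "hyy = Deta (Deta u) s \<xi> \<eta>"
  define \<kappa> where "\<kappa> = - Dt u s \<xi> \<eta> / C"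
  \<comment> \<open>the deviation of \<open>f\<close> from the choice for which the displacement \<open>(\<delta>, e)\<close> is tangent to the level set\<close>
  define g where "g = - (e + \<delta> * p) / 2"
  have ue: "ue > c" "ue > 0" using grad(1)[OF \<open>s < T\<close>, of \<xi> \<eta>] \<open>c > 0\<close> by (auto simp: ue_def)
  have p: "\<bar>p\<bar> \<le> 1" "Dxi u s \<xi> \<eta> = ue * p"
    using grad(2)[OF \<open>s < T\<close>, of \<xi> \<eta>] ue(2) by (auto simp: p_def abs_divide ue_def)
  have \<delta>: "\<bar>\<delta>\<bar> \<le> 2" and e: "\<bar>e\<bar> \<le> 4" using qr f unfolding \<delta>_def e_def by linarith+
  have \<kappa>_bd: "\<bar>\<kappa>\<bar> \<le> K / C"
  proof -
    have "\<bar>\<kappa>\<bar> = \<bar>Dt u s \<xi> \<eta>\<bar> / C" using \<open>C > 0\<close> by (simp add: \<kappa>_def abs_divide)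
    also have "\<dots> \<le> K / C"
      using bd(1)[OF \<open>s < T\<close>, of \<xi> \<eta>] \<open>C > 0\<close> by (intro divide_right_mono) auto
    finally show ?thesis .
  qed
  have ut: "Dt u s \<xi> \<eta> = - C * \<kappa>" using \<open>C > 0\<close> by (simp add: \<kappa>_def)
  have \<kappa>: "\<kappa> = (hxx - p * (hxy + hyx) + p\<^sup>2 * hyy) / 2"
  proof -
    have dir: "perp_grad u s \<xi> \<eta> /\<^sub>R Deta u s \<xi> \<eta> = (-1, p)"
      using ue(2) by (simp add: perp_grad_def p_def ue_def[symmetric] divide_inverse mult.commute)
    have "Dt u s \<xi> \<eta> + 1/2 * C * (hessian u s \<xi> \<eta> (-1, p) \<bullet> (-1, p)) = 0"
      using pde \<open>s < T\<close> unfolding solves_pde_def Let_def dir[symmetric] by blast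
    also have "hessian u s \<xi> \<eta> (-1, p) \<bullet> (-1, p) = hxx - p * (hxy + hyx) + p\<^sup>2 * hyy"
      by (simp add: hessian_def hxx_def hxy_def hyx_def hyy_def algebra_simps power2_eq_square)
    finally have "Dt u s \<xi> \<eta> + 1/2 * C * (hxx - p * (hxy + hyx) + p\<^sup>2 * hyy) = 0" .
    then have "hxx - p * (hxy + hyx) + p\<^sup>2 * hyy = \<kappa> * 2"
      unfolding ut using \<open>C > 0\<close> by simp
    then show ?thesis by simp
  qed
  have "\<bar>\<kappa> * \<beta> m\<bar> \<le> K / C * B"
    unfolding abs_mult using \<kappa>_bd \<beta>B K \<open>C > 0\<close> by (intro mult_mono) auto
  from market_move_beats_investor[OF K \<open>c > 0\<close> \<epsilon>(1,3) less_imp_le[OF ue(1)] this, of g]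
  obtain b :: real where b: "b \<in> {1, -1}" and gain:
    "b * (\<epsilon>\<^sup>2 * (\<kappa> * \<beta> m) - 2 * \<epsilon> * ue * g) - 10 * K * \<epsilon>\<^sup>2 * \<bar>g\<bar> \<ge> - (5 * K * (K / C * B) / c * \<epsilon> ^ 3)"
    by blast
  define x where "x = \<xi> + \<epsilon> * b * \<delta>"
  define y where "y = \<eta> + \<epsilon> * b * e"
  have b2: "b * b = 1" "\<bar>b\<bar> = 1" using b by auto
  have step: "\<bar>\<epsilon> * b * \<delta>\<bar> + \<bar>\<epsilon> * b * e\<bar> \<le> 6 * \<epsilon>"
  proof -
    have "\<bar>\<epsilon> * b * \<delta>\<bar> + \<bar>\<epsilon> * b * e\<bar> = \<epsilon> * (\<bar>\<delta>\<bar> + \<bar>e\<bar>)"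
      using \<epsilon>(1) b2 by (simp add: abs_mult distrib_left)
    also have "\<dots> \<le> \<epsilon> * 6" using \<delta> e \<epsilon>(1) by (intro mult_left_mono) auto
    finally show ?thesis by simp
  qed
  have pow: "\<epsilon>\<^sup>2 * \<epsilon>\<^sup>2 \<le> \<epsilon> ^ 3" "\<epsilon>\<^sup>2 \<le> \<epsilon>"
    using \<epsilon> power_decreasing[of 3 4 \<epsilon>] power_decreasing[of 1 2 \<epsilon>] by (simp_all flip: power_add)

  have time: "u (s + \<epsilon>\<^sup>2) x y \<ge> u s x y + \<epsilon>\<^sup>2 * Dt u s x y - K * \<epsilon> ^ 3"
  proof -
    have "u (s + \<epsilon>\<^sup>2) x y \<ge> u s x y + \<epsilon>\<^sup>2 * Dt u s x y - K * (\<epsilon>\<^sup>2)\<^sup>2"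
      using time_taylor[OF reg'(4-6), of s "s + \<epsilon>\<^sup>2" x y] \<open>\<epsilon>\<^sup>2 > 0\<close> s by simp
    moreover have "K * (\<epsilon>\<^sup>2)\<^sup>2 \<le> K * \<epsilon> ^ 3"
      using pow(1) K by (intro mult_left_mono) (auto simp: power2_eq_square)
    ultimately show ?thesis by linarith
  qed
  have ut_space: "\<bar>Dt u s x y - Dt u s \<xi> \<eta>\<bar> \<le> 6 * K * \<epsilon>"
  proof -
    have "\<bar>Dt u s x y - Dt u s \<xi> \<eta>\<bar> \<le> K * (\<bar>\<epsilon> * b * \<delta>\<bar> + \<bar>\<epsilon> * b * e\<bar>)"
      unfolding x_def y_def by (rule space_lipschitz[OF reg'(7,9,10) \<open>s < T\<close>])
    also have "\<dots> \<le> K * (6 * \<epsilon>)" using step K by (intro mult_left_mono)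
    finally show ?thesis by simp
  qed
  have ut_time: "\<bar>Dt u (s + \<epsilon>\<^sup>2) x y - Dt u s x y\<bar> \<le> K * \<epsilon>"
  proof -
    have "\<bar>Dt u (s + \<epsilon>\<^sup>2) x y - Dt u s x y\<bar> \<le> K * (s + \<epsilon>\<^sup>2 - s)"
      using \<open>\<epsilon>\<^sup>2 > 0\<close> s by (intro time_lipschitz[OF reg'(5) bd(5)]) auto
    also have "\<dots> \<le> K * \<epsilon>" using pow(2) K by (intro mult_left_mono) auto
    finally show ?thesis .
  qed
  have drift: "\<epsilon>\<^sup>2 * Dt u s x y \<ge> - C * \<kappa> * \<epsilon>\<^sup>2 - 6 * K * \<epsilon> ^ 3"
  proof -
    have "\<epsilon>\<^sup>2 * Dt u s x y \<ge> \<epsilon>\<^sup>2 * (- C * \<kappa> - 6 * K * \<epsilon>)"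
      using ut_space unfolding ut by (intro mult_left_mono) auto
    then show ?thesis by (simp add: algebra_simps power2_eq_square power3_eq_cube)
  qed
  have space: "u s x y \<ge> u s \<xi> \<eta> - 2 * \<epsilon> * b * ue * g + \<epsilon>\<^sup>2 * (\<delta>\<^sup>2 * \<kappa>) - 10 * K * \<epsilon>\<^sup>2 * \<bar>g\<bar> - 216 * K * \<epsilon> ^ 3"
  proof -
    have "u s x y \<ge> u s \<xi> \<eta> + (Dxi u s \<xi> \<eta> * (\<epsilon> * b * \<delta>) + Deta u s \<xi> \<eta> * (\<epsilon> * b * e))
        + (hessian u s \<xi> \<eta> (\<epsilon> * b * \<delta>, \<epsilon> * b * e) \<bullet> (\<epsilon> * b * \<delta>, \<epsilon> * b * e)) / 2
        - K * (\<bar>\<epsilon> * b * \<delta>\<bar> + \<bar>\<epsilon> * b * e\<bar>) ^ 3"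
      unfolding x_def y_def by (rule space_taylor[OF reg'(1-3) \<open>s < T\<close>])
    moreover have "Dxi u s \<xi> \<eta> * (\<epsilon> * b * \<delta>) + Deta u s \<xi> \<eta> * (\<epsilon> * b * e) = - 2 * \<epsilon> * b * ue * g"
      unfolding p(2) ue_def[symmetric] g_def by (simp add: algebra_simps)
    moreover have "(hessian u s \<xi> \<eta> (\<epsilon> * b * \<delta>, \<epsilon> * b * e) \<bullet> (\<epsilon> * b * \<delta>, \<epsilon> * b * e)) / 2
        = \<epsilon>\<^sup>2 * ((\<delta>\<^sup>2 * hxx + \<delta> * e * (hxy + hyx) + e\<^sup>2 * hyy) / 2)"
    proof -
      have "hessian u s \<xi> \<eta> (\<epsilon> * b * \<delta>, \<epsilon> * b * e) \<bullet> (\<epsilon> * b * \<delta>, \<epsilon> * b * e)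
          = (b * b) * (\<epsilon>\<^sup>2 * (\<delta>\<^sup>2 * hxx + \<delta> * e * (hxy + hyx) + e\<^sup>2 * hyy))"
        unfolding hxx_def hxy_def hyx_def hyy_def hessian_def
        by (simp add: algebra_simps power2_eq_square)
      then show ?thesis unfolding b2 by simp
    qed
    moreover have "\<epsilon>\<^sup>2 * ((\<delta>\<^sup>2 * hxx + \<delta> * e * (hxy + hyx) + e\<^sup>2 * hyy) / 2)
        \<ge> \<epsilon>\<^sup>2 * (\<delta>\<^sup>2 * \<kappa> - 10 * K * \<bar>g\<bar>)"
    proof (rule mult_left_mono)
      have g_abs: "\<bar>g\<bar> = \<bar>(e + \<delta> * p) / 2\<bar>" unfolding g_def by linarith
      have "\<bar>hxy\<bar> \<le> K" "\<bar>hyx\<bar> \<le> K" "\<bar>hyy\<bar> \<le> K"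
        using bd(2-4)[OF \<open>s < T\<close>, of \<xi> \<eta>] by (simp_all add: hxy_def hyx_def hyy_def)
      from quadratic_form_near_level_set[OF this \<delta> e p(1)]
      show "\<delta>\<^sup>2 * \<kappa> - 10 * K * \<bar>g\<bar> \<le> (\<delta>\<^sup>2 * hxx + \<delta> * e * (hxy + hyx) + e\<^sup>2 * hyy) / 2"
        unfolding \<kappa> g_abs .
    qed simp
    moreover have "K * (\<bar>\<epsilon> * b * \<delta>\<bar> + \<bar>\<epsilon> * b * e\<bar>) ^ 3 \<le> K * (6 * \<epsilon>) ^ 3"
      using step K by (intro mult_left_mono power_mono) auto
    moreover have "\<epsilon>\<^sup>2 * (\<delta>\<^sup>2 * \<kappa> - 10 * K * \<bar>g\<bar>) = \<epsilon>\<^sup>2 * (\<delta>\<^sup>2 * \<kappa>) - 10 * K * \<epsilon>\<^sup>2 * \<bar>g\<bar>"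
      by (simp add: algebra_simps)
    moreover have "K * (6 * \<epsilon>) ^ 3 = 216 * K * \<epsilon> ^ 3"
      by (simp add: power_mult_distrib)
    ultimately show ?thesis by linarith
  qed
  have potential: "\<epsilon>\<^sup>2 * (- Dt u (s + \<epsilon>\<^sup>2) x y / C) * h (next_state m b)
      \<ge> \<epsilon>\<^sup>2 * \<kappa> * h (next_state m b) - 7 * K * B / C * \<epsilon> ^ 3"
  proof -
    let ?D = "- Dt u (s + \<epsilon>\<^sup>2) x y / C - \<kappa>" and ?h = "h (next_state m b)"
    have "\<bar>?D\<bar> = \<bar>Dt u (s + \<epsilon>\<^sup>2) x y - Dt u s \<xi> \<eta>\<bar> / C"
      using \<open>C > 0\<close> by (simp add: \<kappa>_def abs_minus_commute flip: diff_divide_distrib)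
    also have "\<dots> \<le> (7 * K * \<epsilon>) / C"
      using ut_space ut_time \<open>C > 0\<close> by (intro divide_right_mono) auto
    finally have "\<bar>?D * ?h\<bar> \<le> (7 * K * \<epsilon>) / C * B"
      unfolding abs_mult using hB[of b] K \<epsilon> \<open>C > 0\<close> by (intro mult_mono) auto
    then have "?D * ?h \<ge> - ((7 * K * \<epsilon>) / C * B)" by linarith
    then have "\<epsilon>\<^sup>2 * (?D * ?h) \<ge> \<epsilon>\<^sup>2 * (- ((7 * K * \<epsilon>) / C * B))"
      by (intro mult_left_mono) auto
    moreover have "\<epsilon>\<^sup>2 * (- ((7 * K * \<epsilon>) / C * B)) = - (7 * K * B / C * \<epsilon> ^ 3)"
      by (simp add: power2_eq_square power3_eq_cube)
    moreover have "\<epsilon>\<^sup>2 * (?D * ?h) = \<epsilon>\<^sup>2 * (- Dt u (s + \<epsilon>\<^sup>2) x y / C) * ?h - \<epsilon>\<^sup>2 * \<kappa> * ?h"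
      by (simp add: left_diff_distrib right_diff_distrib mult.assoc)
    ultimately show ?thesis by linarith
  qed
  have "corrected C h \<epsilon> u (s + \<epsilon>\<^sup>2) (next_state m b) x y - corrected C h \<epsilon> u s m \<xi> \<eta>
      = u (s + \<epsilon>\<^sup>2) x y - u s \<xi> \<eta>
        + \<epsilon>\<^sup>2 * (- Dt u (s + \<epsilon>\<^sup>2) x y / C) * h (next_state m b) - \<epsilon>\<^sup>2 * \<kappa> * h m"
    by (simp add: corrected_def \<kappa>_def)
  moreover have "\<epsilon>\<^sup>2 * \<kappa> * h (next_state m b) - \<epsilon>\<^sup>2 * \<kappa> * h m + \<epsilon>\<^sup>2 * (\<delta>\<^sup>2 * \<kappa>) - C * \<kappa> * \<epsilon>\<^sup>2
      = \<epsilon>\<^sup>2 * \<kappa> * (b * \<beta> m)"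
  proof -
    have b\<beta>: "b * \<beta> m = \<delta>\<^sup>2 - C + h (next_state m b) - h m"
      using pot[OF b] by (simp add: \<delta>_def)
    show ?thesis unfolding b\<beta> by (simp add: algebra_simps)
  qed
  moreover have "\<epsilon>\<^sup>2 * \<kappa> * (b * \<beta> m) - 2 * \<epsilon> * b * ue * g = b * (\<epsilon>\<^sup>2 * (\<kappa> * \<beta> m) - 2 * \<epsilon> * ue * g)"
    by (simp add: algebra_simps)
  moreover have "(223 * K + 7 * K * B / C) * \<epsilon> ^ 3
      = K * \<epsilon> ^ 3 + 6 * K * \<epsilon> ^ 3 + 216 * K * \<epsilon> ^ 3 + 7 * K * B / C * \<epsilon> ^ 3"
    by (simp add: distrib_right)
  ultimately have "corrected C h \<epsilon> u (s + \<epsilon>\<^sup>2) (next_state m b) x y - corrected C h \<epsilon> u s m \<xi> \<eta>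
      \<ge> b * (\<epsilon>\<^sup>2 * (\<kappa> * \<beta> m) - 2 * \<epsilon> * ue * g) - 10 * K * \<epsilon>\<^sup>2 * \<bar>g\<bar>
        - (223 * K + 7 * K * B / C) * \<epsilon> ^ 3"
    using time drift space potential by linarith
  with gain have "corrected C h \<epsilon> u (s + \<epsilon>\<^sup>2) (next_state m b) x y - corrected C h \<epsilon> u s m \<xi> \<eta>
      \<ge> - (5 * K * (K / C * B) / c * \<epsilon> ^ 3) - (223 * K + 7 * K * B / C) * \<epsilon> ^ 3"
    by linarith
  then have "corrected C h \<epsilon> u (s + \<epsilon>\<^sup>2) (next_state m b) x y
      \<ge> corrected C h \<epsilon> u s m \<xi> \<eta> - (223 * K + 7 * K * B / C + 5 * K * (K / C * B) / c) * \<epsilon> ^ 3"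
    by (simp add: distrib_right)
  with b show ?thesis unfolding x_def y_def \<delta>_def e_def by blast
qed

section \<open>From one step to the value function\<close>

text \<open>A discrete subsolution stays below the value function: whatever \<open>f\<close> the investor chooses, the market has
a reply that keeps the value above \<open>w\<close>.\<close>

lemma value_steps_ge_of_subsolution:
  assumes start: "\<And>m \<xi> \<eta>. m \<in> S \<Longrightarrow> \<phi> \<xi> \<eta> \<ge> w 0 m \<xi> \<eta>"
    and step: "\<And>n m f \<xi> \<eta>. m \<in> S \<Longrightarrow> \<bar>f\<bar> \<le> 1 \<Longrightarrow> \<exists>b\<in>{1, -1}. w n (next_state m b)
       (\<xi> + \<epsilon> * b * (q m - r m)) (\<eta> + \<epsilon> * b * (q m + r m - 2 * f)) \<ge> w (Suc n) m \<xi> \<eta>"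
    and closed: "\<And>m b. m \<in> S \<Longrightarrow> next_state m b \<in> S"
    and "m \<in> S"
  shows "value_steps q r \<phi> \<epsilon> n m \<xi> \<eta> \<ge> w n m \<xi> \<eta>"
  using \<open>m \<in> S\<close>
proof (induction n arbitrary: m \<xi> \<eta>)
  case 0
  then show ?case by (simp add: start)
next
  case (Suc n)
  show ?case
    unfolding value_steps.simps
  proof (rule cINF_greatest)
    show "{f :: real. \<bar>f\<bar> \<le> 1} \<noteq> {}" by (auto intro: exI[of _ 0])
    fix f :: real assume "f \<in> {f. \<bar>f\<bar> \<le> 1}"
    then have "\<bar>f\<bar> \<le> 1" by simp
    from step[OF Suc.prems this, of n \<xi> \<eta>]
    obtain b :: real where b: "b \<in> {1, -1}" and "w n (next_state m b)
       (\<xi> + \<epsilon> * b * (q m - r m)) (\<eta> + \<epsilon> * b * (q m + r m - 2 * f)) \<ge> w (Suc n) m \<xi> \<eta>"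
      by blast
    then have "w (Suc n) m \<xi> \<eta> \<le> value_steps q r \<phi> \<epsilon> n (next_state m b)
       (\<xi> + \<epsilon> * b * (q m - r m)) (\<eta> + \<epsilon> * b * (q m + r m - 2 * f))"
      using Suc.IH[OF closed[OF Suc.prems]] order_trans by blast
    also have "\<dots> \<le> (MAX b\<in>{1, -1}. value_steps q r \<phi> \<epsilon> n (next_state m b)
       (\<xi> + \<epsilon> * b * (q m - r m)) (\<eta> + \<epsilon> * b * (q m + r m - 2 * f)))"
      using b by (intro Max_ge imageI) auto
    finally show "w (Suc n) m \<xi> \<eta> \<le> \<dots>" .
  qed
qed

text \<open>Regularity is available only for times before \<open>T\<close>, so the final data are compared with \<open>u\<close> at an earlier
time, by the bound on the time derivative and the attainment of the data in the limit.\<close>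

lemma final_data_ge:
  assumes "solves_pde C T \<phi> u" "regular_with_bound T K u" "s < T"
  shows "\<phi> \<xi> \<eta> \<ge> u s \<xi> \<eta> - K * (T - s)"
proof (rule tendsto_lowerbound)
  show "((\<lambda>t. u t \<xi> \<eta>) \<longlongrightarrow> \<phi> \<xi> \<eta>) (at_left T)"
    using assms(1) by (simp add: solves_pde_def)
  note reg = regular_with_boundD[OF assms(2)]
  have bd: "\<bar>Dt u t \<xi> \<eta>\<bar> \<le> K" if "t < T" for t
    using reg(8) that by (auto simp: cont_bounded_def)
  have "K \<ge> 0" using bd[OF \<open>s < T\<close>] by linarith
  have "u s \<xi> \<eta> - K * (T - s) \<le> u t \<xi> \<eta>" if "s < t" "t < T" for t
  proof -
    have "\<bar>u t \<xi> \<eta> - u s \<xi> \<eta>\<bar> \<le> K * (t - s)"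
      using that by (intro time_lipschitz[OF reg(4) bd]) auto
    also have "\<dots> \<le> K * (T - s)" using that \<open>K \<ge> 0\<close> by (intro mult_left_mono) auto
    finally show ?thesis by linarith
  qed
  then show "\<forall>\<^sub>F t in at_left T. u s \<xi> \<eta> - K * (T - s) \<le> u t \<xi> \<eta>"
    using \<open>s < T\<close> by (auto simp: eventually_at_left_field)
qed simp

theorem theorem5p5:
  fixes d :: nat
    and q r :: "bool list \<Rightarrow> real"
    and \<phi> :: "real \<Rightarrow> real \<Rightarrow> real"
    and K c :: real
  assumes "d \<ge> 1"
    and "\<And>m. m \<in> states d \<Longrightarrow> \<bar>q m\<bar> < 1"
    and "\<And>m. m \<in> states d \<Longrightarrow> \<bar>r m\<bar> < 1"
    and "\<exists>m\<in>states d. q m \<noteq> r m"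
    and "c > 0"
  shows "\<exists>C. \<exists>\<epsilon>\<^sub>0>0. \<forall>(T::real) u.
           solves_pde (lp_value d q r) T \<phi> u \<and>
           regular_with_bound T K u \<and>
           (\<forall>t<T. \<forall>\<xi> \<eta>. Deta u t \<xi> \<eta> > c) \<and>
           (\<forall>t<T. \<forall>\<xi> \<eta>. \<bar>Dxi u t \<xi> \<eta>\<bar> \<le> Deta u t \<xi> \<eta>) \<and>
           (\<forall>t<T. \<forall>\<xi> \<eta>. Dt u t \<xi> \<eta> \<le> 0) \<longrightarrow>
           (\<forall>\<epsilon> t. 0 < \<epsilon> \<and> \<epsilon> < \<epsilon>\<^sub>0 \<and> t < T \<and> (\<exists>N::nat. (T - t) / \<epsilon>\<^sup>2 = real N) \<longrightarrow>
              (\<forall>m\<in>states d. \<forall>\<xi> \<eta>.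
                 value_fn q r \<phi> T \<epsilon> t m \<xi> \<eta> \<ge> u t \<xi> \<eta> - C * ((T - t) + \<epsilon>) * \<epsilon>))"
proof -
  define C where "C = lp_value d q r"
  have C_mean: "C = (\<Sum>m\<in>states d. (q m - r m)\<^sup>2) / 2 ^ d"
    unfolding C_def by (rule lp_value_eq_mean[OF assms(1)])
  have "C > 0"
  proof -
    obtain m where "m \<in> states d" "q m \<noteq> r m" using assms(4) by blast
    then have "(\<Sum>m\<in>states d. (q m - r m)\<^sup>2) > 0"
      by (intro sum_pos2[OF finite_states]) auto
    then show ?thesis by (simp add: C_mean)
  qed
  obtain h \<beta> where pot: "\<And>m b. m \<in> states d \<Longrightarrow> b \<in> {1, -1} \<Longrightarrow>
      (q m - r m)\<^sup>2 - b * \<beta> m - C = h m - h (next_state m b)"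
    by (rule ex_potential[of d "\<lambda>m. (q m - r m)\<^sup>2", folded C_mean]) (rule that)
  define B where "B = (\<Sum>m\<in>states d. \<bar>h m\<bar> + \<bar>\<beta> m\<bar>)"
  have B: "\<bar>h m\<bar> \<le> B" "\<bar>\<beta> m\<bar> \<le> B" if "m \<in> states d" for m
  proof -
    have "\<bar>h m\<bar> + \<bar>\<beta> m\<bar> \<le> B"
      unfolding B_def using that by (intro member_le_sum) (auto simp: finite_states)
    then show "\<bar>h m\<bar> \<le> B" "\<bar>\<beta> m\<bar> \<le> B" by auto
  qed
  have "B \<ge> 0" unfolding B_def by (intro sum_nonneg) auto
  have closed: "next_state m b \<in> states d" if "m \<in> states d" for m b
    using that assms(1) by (simp add: states_def next_state_def)
  \<comment> \<open>\<open>A\<close> is the error constant of one step; over all steps it accumulates to \<open>A (T - t) \<epsilon>\<close>. The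
    corrector, of size \<open>K B \<epsilon>\<^sup>2 / C\<close>, is discarded at the first and at the last step.\<close>
  define A where "A = 223 * K + 7 * K * B / C + 5 * K * (K / C * B) / c"
  define C' where "C' = A + 2 * K * B / C"
  \<comment> \<open>The absolute value keeps the denominator positive for negative \<open>K\<close>, for which no solution qualifies.\<close>
  define \<epsilon>\<^sub>0 where "\<epsilon>\<^sub>0 = min 1 (c / (5 * \<bar>K\<bar> + 1))"
  have \<epsilon>\<^sub>0: "\<epsilon>\<^sub>0 > 0" using \<open>c > 0\<close> by (simp add: \<epsilon>\<^sub>0_def add_nonneg_pos)
  have bound: "value_fn q r \<phi> T \<epsilon> t m \<xi> \<eta> \<ge> u t \<xi> \<eta> - C' * ((T - t) + \<epsilon>) * \<epsilon>"
    if pde: "solves_pde C T \<phi> u" and reg: "regular_with_bound T K u"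
      and grad: "\<And>t \<xi> \<eta>. t < T \<Longrightarrow> Deta u t \<xi> \<eta> > c"
        "\<And>t \<xi> \<eta>. t < T \<Longrightarrow> \<bar>Dxi u t \<xi> \<eta>\<bar> \<le> Deta u t \<xi> \<eta>"
      and \<epsilon>: "0 < \<epsilon>" "\<epsilon> < \<epsilon>\<^sub>0" and "t < T" and N: "(T - t) / \<epsilon>\<^sup>2 = real N" and m: "m \<in> states d"
    for T u \<epsilon> t N m \<xi> \<eta>
  proof -
    note reg' = regular_with_boundD[OF reg]
    have bd: "\<bar>Dt u s x y\<bar> \<le> K" if "s < T" for s x y
      using reg'(8) that by (auto simp: cont_bounded_def)
    have K: "K \<ge> 0" using bd[OF \<open>t < T\<close>, of 0 0] by linarith
    have \<epsilon>1: "\<epsilon> \<le> 1" using \<epsilon> by (simp add: \<epsilon>\<^sub>0_def)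
    have \<epsilon>c: "5 * K * \<epsilon> \<le> c"
    proof -
      have "\<epsilon> < c / (5 * K + 1)" using \<epsilon> K by (simp add: \<epsilon>\<^sub>0_def)
      then have "\<epsilon> * (5 * K + 1) < c" using K by (simp add: pos_less_divide_eq)
      then show ?thesis using \<epsilon>(1) by (simp add: algebra_simps)
    qed
    have Nt: "real N * \<epsilon>\<^sup>2 = T - t" using N \<epsilon>(1) by (simp add: field_simps)
    have corr_bd: "\<bar>corrected C h \<epsilon> u s m' x y - u s x y\<bar> \<le> K * B / C * \<epsilon>\<^sup>2"
      if "s < T" "m' \<in> states d" for s m' x y
    proof -
      have "\<bar>- Dt u s x y / C\<bar> = \<bar>Dt u s x y\<bar> / C"
        using \<open>C > 0\<close> by (simp add: abs_divide)
      also have "\<dots> \<le> K / C"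
        using bd[OF that(1)] \<open>C > 0\<close> by (intro divide_right_mono) auto
      finally have "\<bar>- Dt u s x y / C\<bar> \<le> K / C" .
      then have "\<bar>- Dt u s x y / C * h m'\<bar> \<le> K / C * B"
        unfolding abs_mult using B(1)[OF that(2)] K \<open>C > 0\<close> by (intro mult_mono) auto
      then have "\<epsilon>\<^sup>2 * \<bar>- Dt u s x y / C * h m'\<bar> \<le> \<epsilon>\<^sup>2 * (K / C * B)"
        by (intro mult_left_mono) auto
      then show ?thesis by (simp add: corrected_def abs_mult mult_ac)
    qed
    \<comment> \<open>The game is compared with \<open>u\<close> shifted back in time by \<open>\<tau>\<close>, so that even its last step stays
      before \<open>T\<close>; the shift costs \<open>K \<tau>\<close> at each end and \<open>\<tau>\<close> tends to 0 afterwards.\<close>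
    have approx: "u t \<xi> \<eta> - C' * ((T - t) + \<epsilon>) * \<epsilon> \<le> value_fn q r \<phi> T \<epsilon> t m \<xi> \<eta> + 2 * K * \<tau>"
      if "\<tau> > 0" for \<tau>
    proof -
      let ?s = "\<lambda>n. T - \<tau> - real n * \<epsilon>\<^sup>2"
      let ?E = "K * \<tau> + K * B / C * \<epsilon>\<^sup>2"
      define w where "w n m' x y = corrected C h \<epsilon> u (?s n) m' x y - A * \<epsilon> ^ 3 * real n - ?E" for n m' x y
      have s: "?s n < T" for n
      proof -
        have "0 \<le> real n * \<epsilon>\<^sup>2" by simp
        then show ?thesis using that by linarith
      qed
      have "value_steps q r \<phi> \<epsilon> N m \<xi> \<eta> \<ge> w N m \<xi> \<eta>"
      proof (rule value_steps_ge_of_subsolution[OF _ _ closed m])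
        show "\<phi> x y \<ge> w 0 m' x y" if "m' \<in> states d" for m' x y
          using final_data_ge[OF pde reg s[of 0], of x y] corr_bd[OF s[of 0] that, of x y]
          unfolding w_def by simp
        show "\<exists>b\<in>{1, -1}. w n (next_state m' b) (x + \<epsilon> * b * (q m' - r m'))
            (y + \<epsilon> * b * (q m' + r m' - 2 * f)) \<ge> w (Suc n) m' x y"
          if m': "m' \<in> states d" and f: "\<bar>f\<bar> \<le> 1" for n m' f x y
        proof -
          have eq: "?s (Suc n) + \<epsilon>\<^sup>2 = ?s n" by (simp add: algebra_simps)
          have lt: "?s (Suc n) + \<epsilon>\<^sup>2 < T" unfolding eq by (rule s)
          show ?thesis
            using one_step_ge[where C = C and h = h and \<beta> = \<beta> and q = q and r = r and m = m' and B = B,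
                OF pde reg grad \<open>C > 0\<close> \<open>c > 0\<close> pot[OF m'] B(1)[OF closed[OF m']] B(2)[OF m']
                  assms(2,3)[OF m'] f \<epsilon>(1) \<epsilon>1 \<epsilon>c lt, of x y]
            unfolding eq A_def[symmetric] w_def
            by (auto simp: algebra_simps)
        qed
      qed
      moreover have "w N m \<xi> \<eta> \<ge> u t \<xi> \<eta> - 2 * K * \<tau> - A * (T - t) * \<epsilon> - 2 * K * B / C * \<epsilon>\<^sup>2"
      proof -
        have sN: "?s N = t - \<tau>" using Nt by simp
        have "\<bar>u t \<xi> \<eta> - u (t - \<tau>) \<xi> \<eta>\<bar> \<le> K * (t - (t - \<tau>))"
          using that \<open>t < T\<close> by (intro time_lipschitz[OF reg'(4) bd]) auto
        then have "\<bar>u t \<xi> \<eta> - u (t - \<tau>) \<xi> \<eta>\<bar> \<le> K * \<tau>" by simp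
        moreover have "A * \<epsilon> ^ 3 * real N = A * (T - t) * \<epsilon>"
          unfolding Nt[symmetric] by (simp add: power2_eq_square power3_eq_cube)
        moreover have "2 * K * B / C * \<epsilon>\<^sup>2 = 2 * (K * B / C * \<epsilon>\<^sup>2)" "2 * K * \<tau> = 2 * (K * \<tau>)"
          by simp_all
        ultimately show ?thesis
          using corr_bd[OF s[of N] m, of \<xi> \<eta>, THEN abs_le_D2] unfolding w_def sN
          by (smt (verit))
      qed
      moreover have "A * (T - t) * \<epsilon> + 2 * K * B / C * \<epsilon>\<^sup>2 \<le> C' * ((T - t) + \<epsilon>) * \<epsilon>"
      proof -
        define E where "E = 2 * K * B / C"
        have "A \<ge> 0" "E \<ge> 0"
          using K \<open>B \<ge> 0\<close> \<open>C > 0\<close> \<open>c > 0\<close> by (auto simp: A_def E_def)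
        then have "0 \<le> A * \<epsilon>\<^sup>2 + E * (T - t) * \<epsilon>"
          using \<open>t < T\<close> \<epsilon>(1) by simp
        then have "A * (T - t) * \<epsilon> + E * \<epsilon>\<^sup>2 \<le> (A + E) * ((T - t) + \<epsilon>) * \<epsilon>"
          by (simp add: algebra_simps power2_eq_square)
        then show ?thesis unfolding C'_def E_def .
      qed
      moreover have "value_fn q r \<phi> T \<epsilon> t = value_steps q r \<phi> \<epsilon> N"
        unfolding value_fn_def N by simp
      ultimately show ?thesis by simp
    qed
    show ?thesis
    proof (rule field_le_epsilon)
      fix \<gamma> :: real assume "\<gamma> > 0"
      then have \<tau>: "\<gamma> / (2 * K + 1) > 0" using K by simp
      have "2 * K * (\<gamma> / (2 * K + 1)) \<le> \<gamma>"
        using K \<open>\<gamma> > 0\<close> by (simp add: field_simps)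
      then show "u t \<xi> \<eta> - C' * ((T - t) + \<epsilon>) * \<epsilon> \<le> value_fn q r \<phi> T \<epsilon> t m \<xi> \<eta> + \<gamma>"
        using approx[OF \<tau>] by linarith
    qed
  qed
  show ?thesis
  proof (rule exI[of _ C'], rule exI[of _ \<epsilon>\<^sub>0], intro conjI allI impI ballI)
    fix T u \<epsilon> t m \<xi> \<eta>
    assume u: "solves_pde (lp_value d q r) T \<phi> u \<and> regular_with_bound T K u \<and>
        (\<forall>t<T. \<forall>\<xi> \<eta>. c < Deta u t \<xi> \<eta>) \<and>
        (\<forall>t<T. \<forall>\<xi> \<eta>. \<bar>Dxi u t \<xi> \<eta>\<bar> \<le> Deta u t \<xi> \<eta>) \<and>
        (\<forall>t<T. \<forall>\<xi> \<eta>. Dt u t \<xi> \<eta> \<le> 0)"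
      and \<epsilon>: "0 < \<epsilon> \<and> \<epsilon> < \<epsilon>\<^sub>0 \<and> t < T \<and> (\<exists>N::nat. (T - t) / \<epsilon>\<^sup>2 = real N)"
      and m: "m \<in> states d"
    obtain N :: nat where "(T - t) / \<epsilon>\<^sup>2 = real N" using \<epsilon> by blast
    then show "value_fn q r \<phi> T \<epsilon> t m \<xi> \<eta> \<ge> u t \<xi> \<eta> - C' * ((T - t) + \<epsilon>) * \<epsilon>"
      by (rule bound[rotated 7]) (use u \<epsilon> m in \<open>simp_all add: C_def\<close>)
  qed (rule \<epsilon>\<^sub>0)
qed

end
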